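(* Let $F_1=\sigma_x\otimes(-i\sigma_x)$, $F_2=\sigma_x\otimes(-i\sigma_y)$, $F_3=\sigma_x\otimes(-i\sigma_z)$, $F_4=(i\sigma_z)\otimes I_2$, $F_5=J_4$ in $M(4,\mathbb{C})$. Consider the basis of $1$-vectors for $Cl(1,6)=M(8,\mathbb{C})$ given by $$K_8,\qquad \begin{pmatrix}F_i & 0_4 \\ 0_4 & -F_i\end{pmatrix}\ (i=1,\dots,5),\qquad J_8 .$$ Then with respect to this basis of $1$-vectors, for every $X\in M(8,\mathbb{C})=Cl(1,6)$: 1. Clifford conjugation is $X^{cc}=P^{-1}X^TP$, where $P=\begin{pmatrix}0_4 & \widehat{J}_4 \\ -\widehat{J}_4 & 0_4\end{pmatrix}$; 2. reversion is $X^{rev}=K_8^{-1}X^*K_8$.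
   Context: Pauli matrices: $\sigma_x=\begin{pmatrix}0 & 1 \\ 1 & 0\end{pmatrix}$, $\sigma_y=\begin{pmatrix}0 & -i \\ i & 0\end{pmatrix}$, $\sigma_z=\begin{pmatrix}1 & 0 \\ 0 & -1\end{pmatrix}$; $\otimes$ is the Kronecker product; $X^*$ is the conjugate transpose. $J_{2n}=\begin{pmatrix}0_n & I_n \\ -I_n & 0_n\end{pmatrix}$, $K_{2n}=\begin{pmatrix}0_n & I_n \\ I_n & 0_n\end{pmatrix}$, $\widehat{J}_4=J_2\oplus(-J_2)$. $Cl(p,q)$ is the real Clifford algebra generated by $p+q$ pairwise anticommuting generators, $p$ of which square to $+1$ and $q$ to $-1$. To say that a set of matrices in a matrix algebra $\mathcal{A}$ (viewed as a real algebra) is a basis of $1$-vectors for $Cl(p,q)=\mathcal{A}$ means that they satisfy these relations and that $\mathcal{A}$ is thereby identified with $Cl(p,q)$; the space of $1$-vectors is their real span. Reversion (resp. Clifford conjugation) is the unique real-linear anti-automorphism fixing $1$ and sending every $1$-vector $v$ to $v$ (resp. $-v$). *)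

theory Defs
  imports
    "Jordan_Normal_Form.Schur_Decomposition"
    "Jordan_Normal_Form.Gauss_Jordan_Elimination"
    "HOL-Library.Poly_Mapping"
    "HOL-Library.FuncSet"
    "HOL-Algebra.QuotRing"
begin

text \<open>
  Words in the letters \<open>0, 1, 2, \<dots>\<close> under concatenation. The type is a copy of \<open>nat list\<close>,
  written additively because \<^theory>\<open>HOL-Library.Poly_Mapping\<close> takes the convolution product over
  a \<open>monoid_add\<close>; finitely supported real functions on words are then the free associative
  unital real algebra on these letters.
\<close>

datatype free_word = Word (letters: "nat list")

instantiation free_word :: monoid_add
begin
definition zero_free_word :: free_word where "0 = Word []"
definition plus_free_word :: "free_word \<Rightarrow> free_word \<Rightarrow> free_word"
  where "v + w = Word (letters v @ letters w)"
instance by standard (auto simp: zero_free_word_def plus_free_word_def)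
end

definition free_gen :: "nat \<Rightarrow> (free_word \<Rightarrow>\<^sub>0 real)" where
  "free_gen i = Poly_Mapping.single (Word [i]) 1"

definition free_scalar :: "real \<Rightarrow> (free_word \<Rightarrow>\<^sub>0 real)" where
  "free_scalar r = Poly_Mapping.single 0 r"

definition free_algebra :: "nat \<Rightarrow> (free_word \<Rightarrow>\<^sub>0 real) ring" where
  "free_algebra n =
    \<lparr>carrier = {x. \<forall>w \<in> Poly_Mapping.keys x. set (letters w) \<subseteq> {..<n}},
     monoid.mult = (*), one = 1, zero = 0, add = (+)\<rparr>"

text \<open>
  The Clifford algebra \<open>Cl(p,q)\<close>, presented by generators and relations. The generators
  with index below \<open>p\<close> square to \<open>1\<close>, the remaining \<open>q\<close> ones to \<open>-1\<close>.
\<close>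

definition clifford_sign :: "nat \<Rightarrow> nat \<Rightarrow> real" where
  "clifford_sign p i = (if i < p then 1 else - 1)"

definition clifford_relations :: "nat \<Rightarrow> nat \<Rightarrow> (free_word \<Rightarrow>\<^sub>0 real) set" where
  "clifford_relations p q =
    {free_gen i * free_gen i - free_scalar (clifford_sign p i) | i. i < p + q} \<union>
    {free_gen i * free_gen j + free_gen j * free_gen i | i j. i < p + q \<and> j < p + q \<and> i \<noteq> j}"

definition clifford_ideal :: "nat \<Rightarrow> nat \<Rightarrow> (free_word \<Rightarrow>\<^sub>0 real) set" where
  "clifford_ideal p q = Idl\<^bsub>free_algebra (p + q)\<^esub> (clifford_relations p q)"

definition Cl :: "nat \<Rightarrow> nat \<Rightarrow> (free_word \<Rightarrow>\<^sub>0 real) set ring" where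
  "Cl p q = free_algebra (p + q) Quot clifford_ideal p q"

definition Cl_class :: "nat \<Rightarrow> nat \<Rightarrow> (free_word \<Rightarrow>\<^sub>0 real) \<Rightarrow> (free_word \<Rightarrow>\<^sub>0 real) set" where
  "Cl_class p q x = clifford_ideal p q +>\<^bsub>free_algebra (p + q)\<^esub> x"

text \<open>
  \<open>one_vector_basis p q d vs\<close>: the matrices \<open>vs\<close> are a basis of \<open>1\<close>-vectors for
  \<open>Cl(p,q) = M(d, \<complex>)\<close>. The isomorphism is one of real algebras: being a ring homomorphism
  that preserves the real multiples of \<open>1\<close>, it is real-linear.
\<close>

definition one_vector_basis :: "nat \<Rightarrow> nat \<Rightarrow> nat \<Rightarrow> complex mat list \<Rightarrow> bool" where
  "one_vector_basis p q d vs \<longleftrightarrow>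
    length vs = p + q \<and> set vs \<subseteq> carrier_mat d d \<and>
    (\<forall>i < p + q. vs ! i * vs ! i = complex_of_real (clifford_sign p i) \<cdot>\<^sub>m 1\<^sub>m d) \<and>
    (\<forall>i < p + q. \<forall>j < p + q. i \<noteq> j \<longrightarrow> vs ! i * vs ! j = - (vs ! j * vs ! i)) \<and>
    (\<exists>\<phi> \<in> ring_iso (Cl p q) (ring_mat TYPE(complex) d ()).
      (\<forall>r. \<phi> (Cl_class p q (free_scalar r)) = complex_of_real r \<cdot>\<^sub>m 1\<^sub>m d) \<and>
      (\<forall>i < p + q. \<phi> (Cl_class p q (free_gen i)) = vs ! i))"

definition one_vectors :: "nat \<Rightarrow> complex mat list \<Rightarrow> complex mat set" where
  "one_vectors d vs =
    {finsum (ring_mat TYPE(complex) d ()) (\<lambda>i. complex_of_real (c i) \<cdot>\<^sub>m vs ! i) {..<length vs}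
      | c :: nat \<Rightarrow> real. True}"

definition real_anti_automorphism :: "nat \<Rightarrow> (complex mat \<Rightarrow> complex mat) \<Rightarrow> bool" where
  "real_anti_automorphism d f \<longleftrightarrow>
    bij_betw f (carrier_mat d d) (carrier_mat d d) \<and>
    (\<forall>X \<in> carrier_mat d d. \<forall>Y \<in> carrier_mat d d. f (X + Y) = f X + f Y) \<and>
    (\<forall>r :: real. \<forall>X \<in> carrier_mat d d.
      f (complex_of_real r \<cdot>\<^sub>m X) = complex_of_real r \<cdot>\<^sub>m f X) \<and>
    (\<forall>X \<in> carrier_mat d d. \<forall>Y \<in> carrier_mat d d. f (X * Y) = f Y * f X) \<and>
    f (1\<^sub>m d) = 1\<^sub>m d"

text \<open>
  Functions on \<open>M(d, \<complex>)\<close> are represented as extensional functions on \<open>carrier_mat d d\<close>,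
  so that the definite descriptions below can single out one function.
\<close>

definition reversion :: "nat \<Rightarrow> complex mat list \<Rightarrow> complex mat \<Rightarrow> complex mat" where
  "reversion d vs = (THE f. f \<in> extensional (carrier_mat d d) \<and>
    real_anti_automorphism d f \<and> (\<forall>v \<in> one_vectors d vs. f v = v))"

definition clifford_conjugation :: "nat \<Rightarrow> complex mat list \<Rightarrow> complex mat \<Rightarrow> complex mat" where
  "clifford_conjugation d vs = (THE f. f \<in> extensional (carrier_mat d d) \<and>
    real_anti_automorphism d f \<and> (\<forall>v \<in> one_vectors d vs. f v = - v))"

definition pauli_x :: "complex mat" where
  "pauli_x = mat_of_rows_list 2 [[0, 1], [1, 0]]"

definition pauli_y :: "complex mat" where
  "pauli_y = mat_of_rows_list 2 [[0, - \<i>], [\<i>, 0]]"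

definition pauli_z :: "complex mat" where
  "pauli_z = mat_of_rows_list 2 [[1, 0], [0, - 1]]"

definition kronecker :: "'a :: times mat \<Rightarrow> 'a mat \<Rightarrow> 'a mat" where
  "kronecker A B = mat (dim_row A * dim_row B) (dim_col A * dim_col B)
    (\<lambda>(i, j). A $$ (i div dim_row B, j div dim_col B) * B $$ (i mod dim_row B, j mod dim_col B))"

text \<open>The argument is half the size: \<open>J_mat n\<close> is \<open>J\<^sub>2\<^sub>n\<close> and \<open>K_mat n\<close> is \<open>K\<^sub>2\<^sub>n\<close>.\<close>

definition J_mat :: "nat \<Rightarrow> complex mat" where
  "J_mat n = four_block_mat (0\<^sub>m n n) (1\<^sub>m n) (- 1\<^sub>m n) (0\<^sub>m n n)"

definition K_mat :: "nat \<Rightarrow> complex mat" where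
  "K_mat n = four_block_mat (0\<^sub>m n n) (1\<^sub>m n) (1\<^sub>m n) (0\<^sub>m n n)"

definition J4_hat :: "complex mat" where
  "J4_hat = diag_block_mat [J_mat 1, - J_mat 1]"

definition F_list :: "complex mat list" where
  "F_list =
    [kronecker pauli_x (- \<i> \<cdot>\<^sub>m pauli_x),
     kronecker pauli_x (- \<i> \<cdot>\<^sub>m pauli_y),
     kronecker pauli_x (- \<i> \<cdot>\<^sub>m pauli_z),
     kronecker (\<i> \<cdot>\<^sub>m pauli_z) (1\<^sub>m 2),
     J_mat 2]"

definition basis_1_6 :: "complex mat list" where
  "basis_1_6 =
    [K_mat 4] @ map (\<lambda>F. four_block_mat F (0\<^sub>m 4 4) (0\<^sub>m 4 4) (- F)) F_list @ [J_mat 4]"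

end

theory Submission
  imports Defs
begin

text \<open>
  A list \<open>vs\<close> of \<open>p + q\<close> complex \<open>d \<times> d\<close> matrices satisfying the Clifford relations defines a
  ring homomorphism \<open>Phi\<close> from the free algebra that kills the Clifford ideal. Conjugation by a
  generator flips the sign of a word whenever the number of its letters other than that generator
  is odd. Hence the real parts of the traces of the \<open>2 ^ (p + q)\<close> increasing words
  multiplied with inverses of each other vanish off the diagonal, the only word needing a separate
  argument being the product of all generators when \<open>p + q\<close> is odd. If
  \<open>2 ^ (p + q) = 2 * d ^ 2\<close>, the increasing words therefore form a real basis of the matrix
  algebra: \<open>Phi\<close> is surjective, and since modulo the ideal every element of the free algebra is a
  combination of increasing words, its kernel is the Clifford ideal.

  Surjectivity also shows that a real anti-automorphism is determined by its values on the
  generators, so the two formulas only have to be compared with the involutions on the seven basis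
  elements; this is a computation with \<open>2 \<times> 2\<close> blocks, as \<open>P\<close> and \<open>K\<close> are their own inverses.
\<close>

section \<open>The free algebra modulo the Clifford relations\<close>

lemma poly_mapping_sum_single:
  "x = (\<Sum>w \<in> Poly_Mapping.keys x. Poly_Mapping.single w (Poly_Mapping.lookup x w))"
  by (rule poly_mapping_eqI)
     (auto simp: lookup_sum lookup_single when_def in_keys_iff)

lemma free_algebra_simps [simp]:
  "monoid.mult (free_algebra n) = (*)" "one (free_algebra n) = 1"
  "zero (free_algebra n) = 0" "add (free_algebra n) = (+)"
  by (simp_all add: free_algebra_def)

lemma mem_free_algebra:
  "x \<in> carrier (free_algebra n) \<longleftrightarrow> (\<forall>w \<in> Poly_Mapping.keys x. set (letters w) \<subseteq> {..<n})"
  by (simp add: free_algebra_def)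

lemma letters_zero [simp]: "letters 0 = []"
  and letters_plus [simp]: "letters (v + w) = letters v @ letters w"
  by (simp_all add: zero_free_word_def plus_free_word_def)

lemma free_algebra_closed [simp, intro]:
  "0 \<in> carrier (free_algebra n)"
  "1 \<in> carrier (free_algebra n)"
  "free_scalar r \<in> carrier (free_algebra n)"
  "i < n \<Longrightarrow> free_gen i \<in> carrier (free_algebra n)"
  "x \<in> carrier (free_algebra n) \<Longrightarrow> y \<in> carrier (free_algebra n) \<Longrightarrow> x + y \<in> carrier (free_algebra n)"
  "x \<in> carrier (free_algebra n) \<Longrightarrow> - x \<in> carrier (free_algebra n)"
  "x \<in> carrier (free_algebra n) \<Longrightarrow> y \<in> carrier (free_algebra n) \<Longrightarrow> x - y \<in> carrier (free_algebra n)"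
  "x \<in> carrier (free_algebra n) \<Longrightarrow> y \<in> carrier (free_algebra n) \<Longrightarrow> x * y \<in> carrier (free_algebra n)"
proof -
  show "0 \<in> carrier (free_algebra n)" "1 \<in> carrier (free_algebra n)"
    "free_scalar r \<in> carrier (free_algebra n)"
    by (simp_all add: mem_free_algebra free_scalar_def)
  show "i < n \<Longrightarrow> free_gen i \<in> carrier (free_algebra n)"
    by (simp add: mem_free_algebra free_gen_def)
  assume x: "x \<in> carrier (free_algebra n)"
  then show "- x \<in> carrier (free_algebra n)"
    by (simp add: mem_free_algebra in_keys_iff)
  assume y: "y \<in> carrier (free_algebra n)"
  show "x + y \<in> carrier (free_algebra n)"
    using Poly_Mapping.keys_add[of x y] x y by (auto simp: mem_free_algebra)
  show "x - y \<in> carrier (free_algebra n)"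
    unfolding mem_free_algebra
  proof
    fix w assume "w \<in> Poly_Mapping.keys (x - y)"
    then have "w \<in> Poly_Mapping.keys x \<or> w \<in> Poly_Mapping.keys y"
      by (auto simp: in_keys_iff lookup_minus)
    with x y show "set (letters w) \<subseteq> {..<n}"
      unfolding mem_free_algebra by blast
  qed
  show "x * y \<in> carrier (free_algebra n)"
    unfolding mem_free_algebra
  proof
    fix w assume "w \<in> Poly_Mapping.keys (x * y)"
    then obtain u v where "w = u + v" "u \<in> Poly_Mapping.keys x" "v \<in> Poly_Mapping.keys y"
      using keys_mult[of x y] by blast
    with x y show "set (letters w) \<subseteq> {..<n}"
      by (simp add: mem_free_algebra)
  qed
qed

lemma single_in_free_algebra:
  "set (letters w) \<subseteq> {..<n} \<Longrightarrow> Poly_Mapping.single w r \<in> carrier (free_algebra n)"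
  by (simp add: mem_free_algebra)

text \<open>Every element is a finite sum of monomials, so additive statements need checking on
  monomials only.\<close>

lemma free_algebra_induct [consumes 1, case_names single add]:
  assumes "x \<in> carrier (free_algebra n)"
    and single: "\<And>w r. set (letters w) \<subseteq> {..<n} \<Longrightarrow> P (Poly_Mapping.single w r)"
    and add: "\<And>x y. x \<in> carrier (free_algebra n) \<Longrightarrow> y \<in> carrier (free_algebra n) \<Longrightarrow>
      P x \<Longrightarrow> P y \<Longrightarrow> P (x + y)"
  shows "P x"
proof -
  let ?f = "\<lambda>w. Poly_Mapping.single w (Poly_Mapping.lookup x w)"
  have "sum ?f W \<in> carrier (free_algebra n) \<and> P (sum ?f W)" if "W \<subseteq> Poly_Mapping.keys x" for W
    using finite_subset[OF that finite_keys] that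
  proof (induction W rule: finite_induct)
    case empty
    \<comment> \<open>The monomial with coefficient 0 is the zero element, so no separate zero case
      is needed.\<close>
    then show ?case using single[of 0 0] by simp
  next
    case (insert w W)
    have "set (letters w) \<subseteq> {..<n}"
      using insert.prems assms(1) by (auto simp: mem_free_algebra)
    then show ?case
      using insert by (auto intro!: add single single_in_free_algebra)
  qed
  from this[OF subset_refl] have "P (sum ?f (Poly_Mapping.keys x))" ..
  then show ?thesis
    by (rule subst[OF poly_mapping_sum_single[symmetric]])
qed

lemma ring_free_algebra: "ring (free_algebra n)"
proof (rule ringI)
  show "abelian_group (free_algebra n)"
  proof (rule abelian_groupI)
    fix x assume "x \<in> carrier (free_algebra n)"
    then show "\<exists>y\<in>carrier (free_algebra n). y \<oplus>\<^bsub>free_algebra n\<^esub> x = \<zero>\<^bsub>free_algebra n\<^esub>"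
      by (intro bexI[of _ "- x"]) auto
  qed (auto simp: add.assoc add.commute)
  show "Group.monoid (free_algebra n)"
    by (rule monoidI) (auto simp: mult.assoc)
qed (auto simp: distrib_left distrib_right)

lemma clifford_relations_subset: "clifford_relations p q \<subseteq> carrier (free_algebra (p + q))"
  by (auto simp: clifford_relations_def)

lemma ideal_clifford_ideal: "ideal (clifford_ideal p q) (free_algebra (p + q))"
  unfolding clifford_ideal_def
  by (rule ring.genideal_ideal[OF ring_free_algebra clifford_relations_subset])

lemma clifford_relation_in_ideal:
  "x \<in> clifford_relations p q \<Longrightarrow> x \<in> clifford_ideal p q"
  unfolding clifford_ideal_def
  using ring.genideal_self[OF ring_free_algebra clifford_relations_subset] by blast

lemma clifford_ideal_closed:
  shows "0 \<in> clifford_ideal p q"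
    and "x \<in> clifford_ideal p q \<Longrightarrow> y \<in> clifford_ideal p q \<Longrightarrow> x + y \<in> clifford_ideal p q"
    and "x \<in> clifford_ideal p q \<Longrightarrow> a \<in> carrier (free_algebra (p + q)) \<Longrightarrow> a * x \<in> clifford_ideal p q"
    and "x \<in> clifford_ideal p q \<Longrightarrow> a \<in> carrier (free_algebra (p + q)) \<Longrightarrow> x * a \<in> clifford_ideal p q"
proof -
  interpret ideal "clifford_ideal p q" "free_algebra (p + q)" by (rule ideal_clifford_ideal)
  show "0 \<in> clifford_ideal p q"
    using additive_subgroup.zero_closed[OF is_additive_subgroup] by simp
  show "x \<in> clifford_ideal p q \<Longrightarrow> y \<in> clifford_ideal p q \<Longrightarrow> x + y \<in> clifford_ideal p q"
    using additive_subgroup.a_closed[OF is_additive_subgroup, of x y] by simp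
  show "x \<in> clifford_ideal p q \<Longrightarrow> a \<in> carrier (free_algebra (p + q)) \<Longrightarrow> a * x \<in> clifford_ideal p q"
    using I_l_closed[of x a] by simp
  show "x \<in> clifford_ideal p q \<Longrightarrow> a \<in> carrier (free_algebra (p + q)) \<Longrightarrow> x * a \<in> clifford_ideal p q"
    using I_r_closed[of x a] by simp
qed

section \<open>Congruence modulo the Clifford ideal and normal forms\<close>

definition cl_cong :: "nat \<Rightarrow> nat \<Rightarrow> (free_word \<Rightarrow>\<^sub>0 real) \<Rightarrow> (free_word \<Rightarrow>\<^sub>0 real) \<Rightarrow> bool" where
  "cl_cong p q x y \<longleftrightarrow> x - y \<in> clifford_ideal p q"

lemma cl_cong_refl [simp]: "cl_cong p q x x"
  by (simp add: cl_cong_def clifford_ideal_closed)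

lemma cl_cong_trans [trans]: "cl_cong p q x y \<Longrightarrow> cl_cong p q y z \<Longrightarrow> cl_cong p q x z"
  using clifford_ideal_closed(2)[of "x - y" p q "y - z"] by (simp add: cl_cong_def)

lemma cl_cong_add: "cl_cong p q x y \<Longrightarrow> cl_cong p q x' y' \<Longrightarrow> cl_cong p q (x + x') (y + y')"
  using clifford_ideal_closed(2)[of "x - y" p q "x' - y'"] by (simp add: cl_cong_def algebra_simps)

lemma cl_cong_mult_left:
  "cl_cong p q x y \<Longrightarrow> a \<in> carrier (free_algebra (p + q)) \<Longrightarrow> cl_cong p q (a * x) (a * y)"
  using clifford_ideal_closed(3)[of "x - y" p q a] by (simp add: cl_cong_def right_diff_distrib)

lemma cl_cong_mult_right:
  "cl_cong p q x y \<Longrightarrow> a \<in> carrier (free_algebra (p + q)) \<Longrightarrow> cl_cong p q (x * a) (y * a)"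
  using clifford_ideal_closed(4)[of "x - y" p q a] by (simp add: cl_cong_def left_diff_distrib)

lemma cl_cong_gen_square:
  "i < p + q \<Longrightarrow> cl_cong p q (free_gen i * free_gen i) (free_scalar (clifford_sign p i))"
  by (auto simp: cl_cong_def clifford_relations_def intro!: clifford_relation_in_ideal)

lemma cl_cong_gen_anticommute:
  "i < p + q \<Longrightarrow> j < p + q \<Longrightarrow> i \<noteq> j \<Longrightarrow>
    cl_cong p q (free_gen i * free_gen j) (- (free_gen j * free_gen i))"
  by (auto simp: cl_cong_def clifford_relations_def intro!: clifford_relation_in_ideal)

definition word_mon :: "nat list \<Rightarrow> real \<Rightarrow> (free_word \<Rightarrow>\<^sub>0 real)" where
  "word_mon w r = Poly_Mapping.single (Word w) r"

lemma word_mon_mult: "word_mon v r * word_mon w s = word_mon (v @ w) (r * s)"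
  by (simp add: word_mon_def mult_single plus_free_word_def)

lemma word_mon_gen: "free_gen i = word_mon [i] 1"
  and word_mon_scalar: "free_scalar r = word_mon [] r"
  by (simp_all add: word_mon_def free_gen_def free_scalar_def zero_free_word_def)

lemma word_mon_closed: "set w \<subseteq> {..<n} \<Longrightarrow> word_mon w r \<in> carrier (free_algebra n)"
  by (simp add: word_mon_def single_in_free_algebra)

text \<open>Insertion sort with signs: a generator is moved to its place in an increasing word.\<close>

lemma cl_cong_Cons_increasing:
  assumes "sorted_wrt (<) w" "set w \<subseteq> {..<p + q}" "i < p + q"
  shows "\<exists>w' s. sorted_wrt (<) w' \<and> set w' \<subseteq> insert i (set w) \<and>
    cl_cong p q (word_mon (i # w) r) (word_mon w' (s * r))"
  using assms
proof (induction w arbitrary: r)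
  case Nil
  show ?case by (rule exI[of _ "[i]"], rule exI[of _ 1]) simp
next
  case (Cons j w)
  consider "i < j" | "i = j" | "j < i" by linarith
  then show ?case
  proof cases
    case 1
    with Cons.prems have "sorted_wrt (<) (i # j # w)" by auto
    then show ?thesis
      by (intro exI[of _ "i # j # w"] exI[of _ 1]) auto
  next
    case 2
    have "cl_cong p q (free_gen i * free_gen i * word_mon w r)
        (free_scalar (clifford_sign p i) * word_mon w r)"
      using Cons.prems by (intro cl_cong_mult_right cl_cong_gen_square word_mon_closed) auto
    with 2 Cons.prems show ?thesis
      by (intro exI[of _ w] exI[of _ "clifford_sign p i"])
         (auto simp: word_mon_gen word_mon_scalar word_mon_mult)
  next
    case 3
    \<comment> \<open>Swapping \<open>i\<close> past \<open>j\<close> costs a sign, which the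
      coefficient absorbs; hence the induction over arbitrary \<open>r\<close>.\<close>
    obtain w' s where w': "sorted_wrt (<) w'" "set w' \<subseteq> insert i (set w)"
      "cl_cong p q (word_mon (i # w) (- r)) (word_mon w' (s * - r))"
      using Cons.IH[of "- r"] Cons.prems by auto
    have "cl_cong p q (free_gen i * free_gen j * word_mon w r)
        (- (free_gen j * free_gen i) * word_mon w r)"
      using Cons.prems 3 by (intro cl_cong_mult_right cl_cong_gen_anticommute word_mon_closed) auto
    also have "- (free_gen j * free_gen i) * word_mon w r = free_gen j * word_mon (i # w) (- r)"
      by (simp add: word_mon_gen word_mon_mult) (simp add: word_mon_def single_uminus)
    also have "cl_cong p q \<dots> (free_gen j * word_mon w' (s * - r))"
      using Cons.prems by (intro cl_cong_mult_left w') auto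
    finally have "cl_cong p q (word_mon (i # j # w) r) (word_mon (j # w') (- s * r))"
      by (simp add: word_mon_gen word_mon_mult)
    \<comment> \<open>Every letter of \<open>w'\<close> is \<open>i\<close> or comes from
      \<open>w\<close>, and all of these exceed \<open>j\<close>.\<close>
    moreover have "sorted_wrt (<) (j # w')"
      using w' Cons.prems 3 by auto
    ultimately show ?thesis using w'(2)
      by (intro exI[of _ "j # w'"] exI[of _ "- s"]) auto
  qed
qed

text \<open>The tail is put into increasing order first; the head is then inserted by
  \<open>cl_cong_Cons_increasing\<close>.\<close>

lemma cl_cong_word_increasing:
  assumes "set w \<subseteq> {..<p + q}"
  shows "\<exists>w' s. sorted_wrt (<) w' \<and> set w' \<subseteq> {..<p + q} \<and>
    cl_cong p q (word_mon w r) (word_mon w' s)"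
  using assms
proof (induction w)
  case Nil
  show ?case by (intro exI[of _ "[]"] exI[of _ r]) auto
next
  case (Cons i w)
  then obtain v t where v: "sorted_wrt (<) v" "set v \<subseteq> {..<p + q}"
    "cl_cong p q (word_mon w r) (word_mon v t)"
    by auto
  have "cl_cong p q (free_gen i * word_mon w r) (free_gen i * word_mon v t)"
    using Cons.prems by (intro cl_cong_mult_left v) auto
  then have *: "cl_cong p q (word_mon (i # w) r) (word_mon (i # v) t)"
    by (simp add: word_mon_gen word_mon_mult)
  obtain w' s where "sorted_wrt (<) w'" "set w' \<subseteq> insert i (set v)"
    "cl_cong p q (word_mon (i # v) t) (word_mon w' (s * t))"
    using cl_cong_Cons_increasing[of v p q i t] v Cons.prems by auto
  with * show ?case
    using v(2) Cons.prems
    by (intro exI[of _ w'] exI[of _ "s * t"]) (auto intro: cl_cong_trans)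
qed

text \<open>A strictly increasing word is determined by its set of letters, so normal forms can be
  indexed by the subsets of \<open>{..<p + q}\<close>.\<close>

definition set_mon :: "nat set \<Rightarrow> real \<Rightarrow> (free_word \<Rightarrow>\<^sub>0 real)" where
  "set_mon S r = word_mon (sorted_list_of_set S) r"

text \<open>Upper bound on the quotient: \<open>2 ^ (p + q)\<close> monomials span it over the
  reals, by the relations alone. Their independence comes later, from traces of matrices.\<close>

lemma cl_cong_normal_form:
  assumes "x \<in> carrier (free_algebra (p + q))"
  shows "\<exists>c. cl_cong p q x (\<Sum>S \<in> Pow {..<p + q}. set_mon S (c S))"
  using assms
proof (induction x rule: free_algebra_induct)
  case (single w r)
  then obtain w' s where w': "sorted_wrt (<) w'" "set w' \<subseteq> {..<p + q}"
    "cl_cong p q (word_mon (letters w) r) (word_mon w' s)"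
    using cl_cong_word_increasing by blast
  have "sorted_list_of_set (set w') = w'"
    using w'(1) by (simp add: sorted_list_of_set.idem_if_sorted_distinct strict_sorted_iff)
  \<comment> \<open>One monomial is spread over all subsets, with coefficient 0 elsewhere, so that
    normal forms add coefficientwise.\<close>
  then have "word_mon w' s = (\<Sum>S \<in> Pow {..<p + q}. if S = set w' then set_mon S s else 0)"
    using w'(2) by (subst sum.delta) (auto simp: set_mon_def)
  also have "\<dots> = (\<Sum>S \<in> Pow {..<p + q}. set_mon S (if S = set w' then s else 0))"
    by (intro sum.cong) (auto simp: set_mon_def word_mon_def)
  finally show ?case
    using w'(3) by (auto simp: word_mon_def)
next
  case (add x y)
  then obtain b c where "cl_cong p q x (\<Sum>S \<in> Pow {..<p + q}. set_mon S (b S))"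
    "cl_cong p q y (\<Sum>S \<in> Pow {..<p + q}. set_mon S (c S))" by blast
  then have "cl_cong p q (x + y) (\<Sum>S \<in> Pow {..<p + q}. set_mon S (b S + c S))"
    by (auto dest: cl_cong_add simp: set_mon_def word_mon_def single_add sum.distrib)
  then show ?case by (rule exI[where x = "\<lambda>S. b S + c S"])
qed

section \<open>Words in matrices satisfying the Clifford relations\<close>

definition mat_tr :: "'a :: comm_monoid_add mat \<Rightarrow> 'a" where
  "mat_tr A = (\<Sum>i<dim_row A. A $$ (i, i))"

lemma mat_tr_mult:
  assumes "A \<in> carrier_mat n m" "B \<in> carrier_mat m n"
  shows "mat_tr (A * B) = (\<Sum>i<n. \<Sum>j<m. A $$ (i, j) * B $$ (j, i))"
  using assms by (auto simp: mat_tr_def scalar_prod_def atLeast0LessThan intro!: sum.cong)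

lemma mat_tr_comm:
  fixes A B :: "'a :: comm_semiring_0 mat"
  assumes "A \<in> carrier_mat n m" "B \<in> carrier_mat m n"
  shows "mat_tr (A * B) = mat_tr (B * A)"
  unfolding mat_tr_mult[OF assms] mat_tr_mult[OF assms(2,1)]
  by (subst sum.swap) (simp add: mult.commute)

lemma mat_tr_smult:
  "A \<in> carrier_mat n n \<Longrightarrow> mat_tr (c \<cdot>\<^sub>m A) = c * (mat_tr A :: 'a :: comm_semiring_0)"
  by (auto simp: mat_tr_def sum_distrib_left)

lemma mat_tr_one: "mat_tr (1\<^sub>m n :: 'a :: comm_semiring_1 mat) = of_nat n"
  by (simp add: mat_tr_def)

lemma one_smult_mat [simp]: "(1 :: 'a :: monoid_mult) \<cdot>\<^sub>m A = A"
  by (rule eq_matI) auto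

lemma smult_smult_mat: "a \<cdot>\<^sub>m (b \<cdot>\<^sub>m A) = (a * b :: 'a :: semigroup_mult) \<cdot>\<^sub>m A"
  by (rule eq_matI) (auto simp: mult.assoc)

text \<open>This is the fact that a one-sided inverse of a square matrix is two-sided.\<close>

lemma dual_families_complete:
  fixes v w :: "'s \<Rightarrow> 'k \<Rightarrow> 'a :: field"
  assumes fin: "finite I" "finite K" and card: "card I = card K"
    and dual: "\<And>s t. s \<in> I \<Longrightarrow> t \<in> I \<Longrightarrow> (\<Sum>k\<in>K. v s k * w t k) = (if s = t then 1 else 0)"
    and "k \<in> K" "l \<in> K"
  shows "(\<Sum>s\<in>I. v s k * w s l) = (if k = l then 1 else 0)"
proof -
  define N where "N = card I"
  obtain f where f: "bij_betw f {0..<N} I"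
    using ex_bij_betw_nat_finite[OF fin(1)] unfolding N_def by blast
  obtain g where g: "bij_betw g {0..<N} K"
    using ex_bij_betw_nat_finite[OF fin(2)] unfolding N_def card by blast
  \<comment> \<open>The rows of \<open>V\<close> and the columns of \<open>W\<close> list the two
    families: \<open>dual\<close> says \<open>V * W = 1\<close>, the claim says
    \<open>W * V = 1\<close>.\<close>
  define V where "V = mat N N (\<lambda>(i, j). v (f i) (g j))"
  define W where "W = mat N N (\<lambda>(j, i). w (f i) (g j))"
  have carr: "V \<in> carrier_mat N N" "W \<in> carrier_mat N N"
    by (simp_all add: V_def W_def)
  have "V * W = 1\<^sub>m N"
  proof (rule eq_matI)
    fix i j assume "i < dim_row (1\<^sub>m N :: 'a mat)" "j < dim_col (1\<^sub>m N :: 'a mat)"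
    then have ij: "i < N" "j < N" by auto
    then have "(V * W) $$ (i, j) = (\<Sum>k\<in>{0..<N}. v (f i) (g k) * w (f j) (g k))"
      using carr by (simp add: V_def W_def scalar_prod_def)
    also have "\<dots> = (\<Sum>k\<in>K. v (f i) k * w (f j) k)"
      by (rule sum.reindex_bij_betw[OF g])
    also have "\<dots> = (if f i = f j then 1 else 0)"
      using ij f by (intro dual) (auto simp: bij_betw_def)
    also have "\<dots> = 1\<^sub>m N $$ (i, j)"
      using ij f by (auto simp: bij_betw_def inj_on_def)
    finally show "(V * W) $$ (i, j) = 1\<^sub>m N $$ (i, j)" .
  qed (use carr in auto)
  then have WV: "W * V = 1\<^sub>m N"
    by (rule mat_mult_left_right_inverse[OF carr])
  obtain a b where ab: "a < N" "b < N" "g a = k" "g b = l"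
    using g assms(5,6) by (force simp: bij_betw_def)
  have "(\<Sum>s\<in>I. v s k * w s l) = (\<Sum>i\<in>{0..<N}. v (f i) k * w (f i) l)"
    by (rule sum.reindex_bij_betw[OF f, symmetric])
  also have "\<dots> = (W * V) $$ (b, a)"
    using ab carr by (simp add: V_def W_def scalar_prod_def mult.commute)
  also have "\<dots> = (if k = l then 1 else 0)"
    unfolding WV using ab g by (auto simp: bij_betw_def inj_on_def)
  finally show ?thesis .
qed

section \<open>Consequences of the relations for products of generators\<close>

locale clifford_matrices =
  fixes p q d :: nat and vs :: "complex mat list"
  assumes vs_carrier: "\<And>i. i < p + q \<Longrightarrow> vs ! i \<in> carrier_mat d d"
    and vs_square: "\<And>i. i < p + q \<Longrightarrow>
      vs ! i * vs ! i = complex_of_real (clifford_sign p i) \<cdot>\<^sub>m 1\<^sub>m d"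
    and vs_anticommute: "\<And>i j. i < p + q \<Longrightarrow> j < p + q \<Longrightarrow> i \<noteq> j \<Longrightarrow>
      vs ! i * vs ! j = - (vs ! j * vs ! i)"
begin

definition mword :: "nat list \<Rightarrow> complex mat" where
  "mword w = foldr (\<lambda>i. (*) (vs ! i)) w (1\<^sub>m d)"

lemma mword_simps [simp]: "mword [] = 1\<^sub>m d" "mword (i # w) = vs ! i * mword w"
  by (simp_all add: mword_def)

lemma mword_carrier: "set w \<subseteq> {..<p + q} \<Longrightarrow> mword w \<in> carrier_mat d d"
  by (induction w) (auto intro!: mult_carrier_mat vs_carrier)

lemma mword_append:
  assumes "set v \<subseteq> {..<p + q}" "set w \<subseteq> {..<p + q}"
  shows "mword (v @ w) = mword v * mword w"
  using assms(1)
proof (induction v)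
  case Nil
  then show ?case using mword_carrier[OF assms(2)] by simp
next
  case (Cons i v)
  then show ?case
    using mword_carrier[OF assms(2)] mword_carrier[of v] vs_carrier[of i]
    by (simp add: assoc_mult_mat[where ?n\<^sub>1 = d and ?n\<^sub>2 = d and ?n\<^sub>3 = d and ?n\<^sub>4 = d])
qed

text \<open>Each letter that \<open>vs ! i\<close> passes contributes a factor -1 if it differs from
  \<open>i\<close>, and none if it equals \<open>i\<close>.\<close>

lemma vs_mword_commute:
  assumes "i < p + q" "set w \<subseteq> {..<p + q}"
  shows "vs ! i * mword w = (- 1) ^ length (filter ((\<noteq>) i) w) \<cdot>\<^sub>m (mword w * vs ! i)"
  using assms(2)
proof (induction w)
  case Nil
  then show ?case using vs_carrier[OF assms(1)] by simp
next
  case (Cons j w)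
  let ?c = "(- 1) ^ length (filter ((\<noteq>) i) w) :: complex"
  have carr: "vs ! i \<in> carrier_mat d d" "vs ! j \<in> carrier_mat d d" "mword w \<in> carrier_mat d d"
    using assms(1) Cons.prems by (auto intro!: vs_carrier mword_carrier)
  note [simp] = assoc_mult_mat[where ?n\<^sub>1 = d and ?n\<^sub>2 = d and ?n\<^sub>3 = d and ?n\<^sub>4 = d]
  have IH: "vs ! i * mword w = ?c \<cdot>\<^sub>m (mword w * vs ! i)"
    using Cons by simp
  show ?case
  proof (cases "i = j")
    case True
    then have "vs ! i * mword (j # w) = vs ! j * (vs ! i * mword w)" by simp
    with True carr show ?thesis
      unfolding IH by (simp add: mult_smult_distrib[where n = d and nr = d and nc = d])
  next
    case False
    have "vs ! i * mword (j # w) = (vs ! i * vs ! j) * mword w"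
      using carr by simp
    also have "\<dots> = - (vs ! j * (vs ! i * mword w))"
      using carr assms(1) Cons.prems False by (subst vs_anticommute) auto
    also have "\<dots> = - (?c \<cdot>\<^sub>m (vs ! j * mword w * vs ! i))"
      using carr unfolding IH
      by (simp add: mult_smult_distrib[where n = d and nr = d and nc = d])
    also have "\<dots> = - ?c \<cdot>\<^sub>m (mword (j # w) * vs ! i)"
      using carr by (intro eq_matI) auto
    finally show ?thesis using False by simp
  qed
qed

lemma clifford_sign_cases: "clifford_sign p i = 1 \<or> clifford_sign p i = - 1"
  by (simp add: clifford_sign_def)

text \<open>By cyclicity of the trace, \<open>mword w * vs ! i * vs ! i\<close> and
  \<open>vs ! i * mword w * vs ! i\<close> have equal traces, while moving \<open>vs ! i\<close>
  across the word gives the opposite sign. As \<open>vs ! i\<close> squares to a nonzero scalar, the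
  trace of the word vanishes.\<close>

lemma mat_tr_mword_eq_0:
  assumes "i < p + q" "set w \<subseteq> {..<p + q}" "odd (length (filter ((\<noteq>) i) w))"
  shows "mat_tr (mword w) = 0"
proof -
  note [simp] = assoc_mult_mat[where ?n\<^sub>1 = d and ?n\<^sub>2 = d and ?n\<^sub>3 = d and ?n\<^sub>4 = d]
  let ?s = "complex_of_real (clifford_sign p i)"
  let ?c = "(- 1) ^ length (filter ((\<noteq>) i) w) :: complex"
  have carr: "vs ! i \<in> carrier_mat d d" "mword w \<in> carrier_mat d d"
    using assms by (auto intro!: vs_carrier mword_carrier)
  have sq: "mword w * vs ! i * vs ! i = ?s \<cdot>\<^sub>m mword w"
    using carr assms(1) by (simp add: vs_square mult_smult_distrib[where n = d and nr = d and nc = d])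
  have "?s * mat_tr (mword w) = mat_tr (mword w * vs ! i * vs ! i)"
    using carr by (simp only: sq mat_tr_smult)
  also have "\<dots> = mat_tr (vs ! i * mword w * vs ! i)"
    using carr mat_tr_comm[of "mword w * vs ! i" d d "vs ! i"] by simp
  also have "\<dots> = ?c * mat_tr (mword w * vs ! i * vs ! i)"
    using carr vs_mword_commute[OF assms(1,2)]
    by (simp add: mat_tr_smult[where n = d] mult_smult_assoc_mat[where n = d and nr = d and nc = d] del: assoc_mult_mat)
  also have "\<dots> = - ?s * mat_tr (mword w)"
    using carr assms(3) by (simp only: sq mat_tr_smult) simp
  finally show ?thesis
    using clifford_sign_cases[of i] by auto
qed

text \<open>The first letter of \<open>v\<close> is located in \<open>w\<close> and pulled to the
  front, which changes at most the sign; the rest follows by induction.\<close>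

lemma mword_permute:
  assumes "mset v = mset w" "set w \<subseteq> {..<p + q}"
  shows "\<exists>s \<in> {1, - 1}. mword v = s \<cdot>\<^sub>m mword w"
  using assms
proof (induction v arbitrary: w)
  case Nil
  then show ?case by (intro bexI[of _ 1]) auto
next
  case (Cons i v)
  then have "i \<in> set w" by (metis list.set_intros(1) mset_eq_setD)
  then obtain w1 w2 where w: "w = w1 @ i # w2" by (meson split_list)
  have i: "i < p + q" and sub: "set w1 \<subseteq> {..<p + q}" "set w2 \<subseteq> {..<p + q}"
    using Cons.prems w by auto
  have "mset v = mset (w1 @ w2)" "set (w1 @ w2) \<subseteq> {..<p + q}"
    using Cons.prems w by auto
  then obtain s where s: "s \<in> {1, - 1}" "mword v = s \<cdot>\<^sub>m mword (w1 @ w2)"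
    using Cons.IH by blast
  let ?c = "(- 1) ^ length (filter ((\<noteq>) i) w1) :: complex"
  have c: "?c \<in> {1, - 1}" by (simp add: minus_one_power_iff)
  have carr: "vs ! i \<in> carrier_mat d d" "mword w1 \<in> carrier_mat d d" "mword w2 \<in> carrier_mat d d"
    using i sub by (auto intro!: vs_carrier mword_carrier)
  have "mword (i # v) = s \<cdot>\<^sub>m (vs ! i * mword w1 * mword w2)"
    using carr sub
    by (simp add: s(2) mword_append mult_smult_distrib[where n = d and nr = d and nc = d]
        assoc_mult_mat[where ?n\<^sub>1 = d and ?n\<^sub>2 = d and ?n\<^sub>3 = d and ?n\<^sub>4 = d])
  also have "\<dots> = s \<cdot>\<^sub>m (?c \<cdot>\<^sub>m (mword w1 * vs ! i * mword w2))"
    using carr unfolding vs_mword_commute[OF i sub(1)]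
    by (simp add: mult_smult_assoc_mat[where n = d and nr = d and nc = d])
  also have "mword w1 * vs ! i * mword w2 = mword w"
    using carr sub i mword_append[of w1 "i # w2"]
    by (simp add: w assoc_mult_mat[where ?n\<^sub>1 = d and ?n\<^sub>2 = d and ?n\<^sub>3 = d and ?n\<^sub>4 = d])
  finally have "mword (i # v) = (s * ?c) \<cdot>\<^sub>m mword w"
    by (simp add: smult_smult_mat)
  moreover have "s * ?c \<in> {1, - 1}" using s(1) c by auto
  ultimately show ?case by blast
qed

text \<open>The product collapses from the middle outwards, each generator meeting itself. Thus the
  reversed word is the inverse up to sign.\<close>

lemma mword_rev:
  assumes "set w \<subseteq> {..<p + q}"
  shows "\<exists>s \<in> {1, - 1}. mword w * mword (rev w) = complex_of_real s \<cdot>\<^sub>m 1\<^sub>m d"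
  using assms
proof (induction w)
  case Nil
  then show ?case by (intro bexI[of _ 1]) auto
next
  case (Cons i w)
  then have "set w \<subseteq> {..<p + q}" by simp
  then obtain s where s: "s \<in> {1, - 1}" "mword w * mword (rev w) = complex_of_real s \<cdot>\<^sub>m 1\<^sub>m d"
    using Cons.IH by blast
  have i: "i < p + q" and w: "set w \<subseteq> {..<p + q}" "set (rev w) \<subseteq> {..<p + q}"
    using Cons.prems by auto
  note [simp] = assoc_mult_mat[where ?n\<^sub>1 = d and ?n\<^sub>2 = d and ?n\<^sub>3 = d and ?n\<^sub>4 = d]
  have carr: "vs ! i \<in> carrier_mat d d" "mword w \<in> carrier_mat d d" "mword (rev w) \<in> carrier_mat d d"
    using i w by (auto intro!: vs_carrier mword_carrier)
  have "mword (i # w) * mword (rev (i # w)) = vs ! i * (mword w * mword (rev w)) * vs ! i"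
    using carr i w by (simp add: mword_append)
  also have "\<dots> = complex_of_real s \<cdot>\<^sub>m (vs ! i * vs ! i)"
    using carr unfolding s(2)
    by (simp add: mult_smult_assoc_mat[where n = d and nr = d and nc = d]
        mult_smult_distrib[where n = d and nr = d and nc = d])
  also have "\<dots> = complex_of_real (s * clifford_sign p i) \<cdot>\<^sub>m 1\<^sub>m d"
    using i by (simp add: vs_square smult_smult_mat)
  finally show ?case
    using s(1) clifford_sign_cases[of i] by (intro bexI[of _ "s * clifford_sign p i"]) auto
qed

end

section \<open>Trace duality and the real basis of increasing words\<close>

lemma sum_complex_parts:
  "(\<Sum>k\<in>A \<times> (UNIV :: bool set). g k) = (\<Sum>a\<in>A. g (a, True) + g (a, False))"
  for g :: "_ \<Rightarrow> 'a :: comm_monoid_add"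
  by (simp add: sum.cartesian_product' UNIV_bool add.commute)

lemma length_filter_neq_distinct:
  "distinct w \<Longrightarrow> length (filter ((\<noteq>) i) w) + (if i \<in> set w then 1 else 0) = length w"
  by (induction w) (auto split: if_splits)

text \<open>By \<open>dim\<close>, there are as many increasing words as the real dimension of the
  matrix algebra. The condition \<open>odd_trace\<close> excludes degenerate representations: with
  \<open>p = 1\<close>, \<open>q = 0\<close>, \<open>d = 1\<close> and the generator 1, the empty
  word and the generator would coincide.\<close>

locale clifford_basis = clifford_matrices +
  assumes dim: "2 ^ (p + q) = 2 * d ^ 2"
    and odd_trace: "odd (p + q) \<Longrightarrow> Re (mat_tr (mword [0..<p + q])) = 0"
begin

definition coord :: "complex mat \<Rightarrow> (nat \<times> nat) \<times> bool \<Rightarrow> real" where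
  "coord A = (\<lambda>((i, j), b). if b then Re (A $$ (i, j)) else Im (A $$ (i, j)))"

text \<open>The transposed index and the sign of the imaginary part make the pairing with
  \<open>coord\<close> equal to the real trace form \<open>Re (mat_tr (A * B))\<close>.\<close>

definition dual_coord :: "complex mat \<Rightarrow> (nat \<times> nat) \<times> bool \<Rightarrow> real" where
  "dual_coord A = (\<lambda>((i, j), b). if b then Re (A $$ (j, i)) else - Im (A $$ (j, i)))"

abbreviation coords :: "((nat \<times> nat) \<times> bool) set" where
  "coords \<equiv> ({..<d} \<times> {..<d}) \<times> UNIV"

lemma sum_coord_dual_coord:
  assumes "A \<in> carrier_mat d d" "B \<in> carrier_mat d d"
  shows "(\<Sum>k\<in>coords. coord A k * dual_coord B k) = Re (mat_tr (A * B))"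
  unfolding mat_tr_mult[OF assms] sum_complex_parts
  by (simp add: coord_def dual_coord_def sum.cartesian_product')

abbreviation set_word :: "nat set \<Rightarrow> nat list" where
  "set_word S \<equiv> sorted_list_of_set S"

lemma set_word_subset: "S \<in> Pow {..<p + q} \<Longrightarrow> set (set_word S) \<subseteq> {..<p + q}"
  by (metis PowD finite_lessThan finite_subset set_sorted_list_of_set)

lemma d_pos: "d > 0"
  using dim by (cases d) auto

text \<open>The product is a single word \<open>?w\<close>. Its number of letters other than
  \<open>i\<close> is \<open>card S + card T\<close> minus one for each of the two sets containing
  \<open>i\<close>. An odd number for some \<open>i\<close> kills the trace; if all are even,
  \<open>S\<close> and \<open>T\<close> turn out to be complementary.\<close>

lemma trace_orthogonal:
  assumes S: "S \<in> Pow {..<p + q}" and T: "T \<in> Pow {..<p + q}" and "S \<noteq> T"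
  shows "Re (mat_tr (mword (set_word S) * mword (rev (set_word T)))) = 0"
proof -
  have fin: "finite S" "finite T" using S T finite_subset by auto
  let ?w = "set_word S @ rev (set_word T)"
  have sub: "set ?w \<subseteq> {..<p + q}"
    using set_word_subset[OF S] set_word_subset[OF T] by simp
  have tr: "mword (set_word S) * mword (rev (set_word T)) = mword ?w"
    using sub by (simp add: mword_append)
  have count: "length (filter ((\<noteq>) i) ?w) + ((if i \<in> S then 1 else 0) + (if i \<in> T then 1 else 0))
      = card S + card T" for i
    using length_filter_neq_distinct[of "set_word S" i] length_filter_neq_distinct[of "set_word T" i] fin
    by (simp flip: rev_filter)
  show ?thesis
  proof (cases "\<exists>i<p + q. odd (length (filter ((\<noteq>) i) ?w))")
    case True
    then show ?thesis unfolding tr using mat_tr_mword_eq_0[OF _ sub] by force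
  next
    case False
    have par: "even (card S + card T) = ((i \<in> S) = (i \<in> T))" if "i < p + q" for i
    proof -
      have "even (length (filter ((\<noteq>) i) ?w))" using False that by blast
      with count[of i] show ?thesis by (auto split: if_splits) presburger+
    qed
    \<comment> \<open>One index on which \<open>S\<close> and \<open>T\<close> differ makes the
      parity odd, and by \<open>par\<close> they then differ at every index.\<close>
    obtain i where "i < p + q" "(i \<in> S) \<noteq> (i \<in> T)"
      using S T assms(3) by blast
    with par have odd: "odd (card S + card T)" by blast
    with par S T have compl: "T = {..<p + q} - S" by blast
    then have "card S + card T = p + q"
      using S fin by (simp add: card_Diff_subset) (metis PowD card_lessThan card_mono finite_lessThan le_add_diff_inverse)
    with odd have "odd (p + q)" by simp
    \<comment> \<open>Now \<open>?w\<close> contains every generator exactly once, so up to sign it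
      is the product covered by \<open>odd_trace\<close>.\<close>
    have "distinct ?w" "set ?w = set [0..<p + q]"
      using S fin compl by auto
    then have "mset ?w = mset [0..<p + q]"
      by (metis distinct_upt mset_set_set)
    moreover have full: "set [0..<p + q] \<subseteq> {..<p + q}" by auto
    ultimately obtain s where "s \<in> {1, - 1}" "mword ?w = s \<cdot>\<^sub>m mword [0..<p + q]"
      using mword_permute by blast
    then show ?thesis
      unfolding tr using odd_trace[OF \<open>odd (p + q)\<close>] mword_carrier[OF full]
      by (auto simp: mat_tr_smult[where n = d])
  qed
qed

text \<open>The reversed word is the inverse up to sign, so the number divided by is
  \<open>d\<close> or \<open>- d\<close>.\<close>

definition dual_mword :: "nat set \<Rightarrow> complex mat" where
  "dual_mword S = complex_of_real (1 / Re (mat_tr (mword (set_word S) * mword (rev (set_word S)))))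
    \<cdot>\<^sub>m mword (rev (set_word S))"

lemma dual_mword_carrier: "S \<in> Pow {..<p + q} \<Longrightarrow> dual_mword S \<in> carrier_mat d d"
  using mword_carrier[of "rev (set_word S)"] set_word_subset[of S] by (simp add: dual_mword_def)

lemma trace_dual:
  assumes S: "S \<in> Pow {..<p + q}" and T: "T \<in> Pow {..<p + q}"
  shows "(\<Sum>k\<in>coords. coord (mword (set_word S)) k * dual_coord (dual_mword T) k) =
    (if S = T then 1 else 0)"
proof -
  let ?t = "\<lambda>S T. Re (mat_tr (mword (set_word S) * mword (rev (set_word T))))"
  have carr: "mword (set_word S) \<in> carrier_mat d d" "mword (rev (set_word T)) \<in> carrier_mat d d"
    using set_word_subset[OF S] set_word_subset[OF T] by (metis mword_carrier set_rev)+
  have "(\<Sum>k\<in>coords. coord (mword (set_word S)) k * dual_coord (dual_mword T) k) = ?t S T / ?t T T"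
    using carr dual_mword_carrier[OF T]
    by (simp add: sum_coord_dual_coord)
       (simp add: dual_mword_def mult_smult_distrib[where n = d and nr = d and nc = d]
          mat_tr_smult[where n = d] Re_divide_of_real)
  moreover have "?t T T \<noteq> 0"
  proof -
    obtain s where "s \<in> {1, - 1}"
      "mword (set_word T) * mword (rev (set_word T)) = complex_of_real s \<cdot>\<^sub>m 1\<^sub>m d"
      using mword_rev[OF set_word_subset[OF T]] by blast
    then show ?thesis using d_pos by (auto simp: mat_tr_smult[where n = d] mat_tr_one)
  qed
  ultimately show ?thesis
    using trace_orthogonal[OF S T] by auto
qed

text \<open>Pairing the vanishing combination with the dual element of \<open>T\<close> isolates the
  coefficient \<open>c T\<close>.\<close>

lemma independent:
  assumes "\<And>i j. i < d \<Longrightarrow> j < d \<Longrightarrow>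
      (\<Sum>S\<in>Pow {..<p + q}. complex_of_real (c S) * mword (set_word S) $$ (i, j)) = 0"
    and T: "T \<in> Pow {..<p + q}"
  shows "c T = 0"
proof -
  have zero: "(\<Sum>S\<in>Pow {..<p + q}. c S * coord (mword (set_word S)) k) = 0" if k: "k \<in> coords" for k
  proof -
    obtain i j b where k: "k = ((i, j), b)" "i < d" "j < d" using k by auto
    \<comment> \<open>The coefficients are real, so one complex equation gives the equations for
      both real coordinates.\<close>
    from arg_cong[OF assms(1)[OF k(2,3)], of Re] arg_cong[OF assms(1)[OF k(2,3)], of Im]
    show ?thesis unfolding k(1) by (cases b) (simp_all add: coord_def)
  qed
  have "c T = (\<Sum>S\<in>Pow {..<p + q}. c S * (if S = T then 1 else 0))"
    using T by (simp add: sum.delta if_distrib cong: if_cong)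
  also have "\<dots> = (\<Sum>S\<in>Pow {..<p + q}. c S *
      (\<Sum>k\<in>coords. coord (mword (set_word S)) k * dual_coord (dual_mword T) k))"
    using T by (intro sum.cong) (simp_all add: trace_dual)
  also have "\<dots> = (\<Sum>k\<in>coords. (\<Sum>S\<in>Pow {..<p + q}. c S * coord (mword (set_word S)) k) *
      dual_coord (dual_mword T) k)"
    unfolding sum_distrib_left sum_distrib_right by (subst sum.swap) (simp add: mult.assoc)
  also have "\<dots> = 0" by (simp add: zero del: mem_Times_iff)
  finally show ?thesis .
qed

text \<open>Two dual families as large as the set of coordinates are complete, so the coefficients
  of \<open>X\<close> are its pairings with the dual words.\<close>

lemma spanning:
  "\<exists>c. \<forall>i<d. \<forall>j<d. X $$ (i, j) =
    (\<Sum>S\<in>Pow {..<p + q}. complex_of_real (c S) * mword (set_word S) $$ (i, j))"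
proof -
  let ?v = "\<lambda>S. coord (mword (set_word S))" and ?w = "\<lambda>S. dual_coord (dual_mword S)"
  define c where "c S = (\<Sum>l\<in>coords. coord X l * ?w S l)" for S
  \<comment> \<open>The equation \<open>dim\<close> makes the matrix of coordinates square, as
    \<open>dual_families_complete\<close> requires.\<close>
  have card: "card (Pow {..<p + q}) = card coords"
    using dim by (simp add: card_Pow card_cartesian_product UNIV_bool power2_eq_square)
  have complete: "(\<Sum>S\<in>Pow {..<p + q}. ?v S k * ?w S l) = (if k = l then 1 else 0)"
    if "k \<in> coords" "l \<in> coords" for k l
    by (rule dual_families_complete[OF _ _ card trace_dual that]) simp_all
  have X: "coord X k = (\<Sum>S\<in>Pow {..<p + q}. c S * ?v S k)" if k: "k \<in> coords" for k
  proof -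
    have "coord X k = (\<Sum>l\<in>coords. coord X l * (if k = l then 1 else 0))"
      using k by (simp add: if_distrib cong: if_cong)
    also have "\<dots> = (\<Sum>l\<in>coords. coord X l * (\<Sum>S\<in>Pow {..<p + q}. ?v S k * ?w S l))"
      using k complete by (intro sum.cong) simp_all
    also have "\<dots> = (\<Sum>S\<in>Pow {..<p + q}. c S * ?v S k)"
      unfolding c_def sum_distrib_left sum_distrib_right
      by (subst sum.swap) (simp add: mult_ac)
    finally show ?thesis .
  qed
  show ?thesis
  proof (intro exI[of _ c] allI impI)
    fix i j assume "i < d" "j < d"
    then show "X $$ (i, j) =
        (\<Sum>S\<in>Pow {..<p + q}. complex_of_real (c S) * mword (set_word S) $$ (i, j))"
      using X[of "((i, j), True)"] X[of "((i, j), False)"]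
      by (intro complex_eqI) (simp_all add: coord_def)
  qed
qed

end

section \<open>The isomorphism with the matrix algebra\<close>

context clifford_matrices
begin

text \<open>The linear extension of \<open>mword\<close>. Summing entry by entry makes it additive
  on the whole type; its values on monomials are computed for letters below \<open>p + q\<close>,
  where \<open>mword\<close> has size \<open>d\<close>.\<close>

definition Phi :: "(free_word \<Rightarrow>\<^sub>0 real) \<Rightarrow> complex mat" where
  "Phi x = mat d d (\<lambda>(i, j). \<Sum>w\<in>Poly_Mapping.keys x.
    complex_of_real (Poly_Mapping.lookup x w) * mword (letters w) $$ (i, j))"

lemma Phi_carrier [simp]: "Phi x \<in> carrier_mat d d"
  by (simp add: Phi_def)

lemma Phi_dim [simp]: "dim_row (Phi x) = d" "dim_col (Phi x) = d"
  by (simp_all add: Phi_def)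

lemma Phi_add: "Phi (x + y) = Phi x + Phi y"
proof (rule eq_matI)
  fix i j assume "i < dim_row (Phi x + Phi y)" "j < dim_col (Phi x + Phi y)"
  then have ij: "i < d" "j < d" by simp_all
  have "(\<Sum>w\<in>Poly_Mapping.keys (x + y).
      complex_of_real (Poly_Mapping.lookup (x + y) w) * mword (letters w) $$ (i, j)) =
    (\<Sum>w\<in>Poly_Mapping.keys x.
      complex_of_real (Poly_Mapping.lookup x w) * mword (letters w) $$ (i, j)) +
    (\<Sum>w\<in>Poly_Mapping.keys y.
      complex_of_real (Poly_Mapping.lookup y w) * mword (letters w) $$ (i, j))"
    by (rule setsum_keys_plus_distrib) (auto simp: distrib_right)
  with ij show "Phi (x + y) $$ (i, j) = (Phi x + Phi y) $$ (i, j)"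
    by (simp add: Phi_def)
qed simp_all

lemma Phi_diff: "Phi (x - y) = Phi x - Phi y"
  using Phi_add[of "x - y" y] by (intro eq_matI) auto

lemma Phi_zero: "Phi 0 = 0\<^sub>m d d"
  by (rule eq_matI) (auto simp: Phi_def)

lemma Phi_single:
  assumes "set (letters w) \<subseteq> {..<p + q}"
  shows "Phi (Poly_Mapping.single w r) = complex_of_real r \<cdot>\<^sub>m mword (letters w)"
  using mword_carrier[OF assms] by (intro eq_matI) (auto simp: Phi_def)

lemma Phi_word_mon:
  "set w \<subseteq> {..<p + q} \<Longrightarrow> Phi (word_mon w r) = complex_of_real r \<cdot>\<^sub>m mword w"
  by (simp add: word_mon_def Phi_single)

lemma Phi_scalar: "Phi (free_scalar r) = complex_of_real r \<cdot>\<^sub>m 1\<^sub>m d"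
  by (simp add: word_mon_scalar Phi_word_mon)

lemma Phi_gen: "i < p + q \<Longrightarrow> Phi (free_gen i) = vs ! i"
  using vs_carrier[of i] by (simp add: word_mon_gen Phi_word_mon)

lemma Phi_mult:
  assumes "x \<in> carrier (free_algebra (p + q))" "y \<in> carrier (free_algebra (p + q))"
  shows "Phi (x * y) = Phi x * Phi y"
  using assms(1)
proof (induction x rule: free_algebra_induct)
  case (single v r)
  note v = single
  show ?case using assms(2)
  proof (induction y rule: free_algebra_induct)
    case (single w s)
    have "mword (letters v) \<in> carrier_mat d d" "mword (letters w) \<in> carrier_mat d d"
      using v single by (auto intro!: mword_carrier)
    with v single show ?case
      by (simp add: mult_single Phi_single mword_append smult_smult_mat mult.commute[of _ "complex_of_real s"]
          mult_smult_assoc_mat[where n = d and nr = d and nc = d]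
          mult_smult_distrib[where n = d and nr = d and nc = d])
  next
    case (add x y)
    then show ?case
      by (simp add: distrib_left Phi_add mult_add_distrib_mat[where n = d and nr = d and nc = d])
  qed
next
  case (add x y)
  then show ?case
    by (simp add: distrib_right Phi_add add_mult_distrib_mat[where n = d and nr = d and nc = d])
qed

lemma Phi_one: "Phi 1 = 1\<^sub>m d"
  using Phi_scalar[of 1] by (simp add: free_scalar_def)

lemma Phi_ring_hom: "ring_hom_ring (free_algebra (p + q)) (ring_mat TYPE(complex) d ()) Phi"
proof (rule ring_hom_ringI2[OF ring_free_algebra ring_mat])
  show "Phi \<in> Ring.ring_hom (free_algebra (p + q)) (ring_mat TYPE(complex) d ())"
    by (rule ring_hom_memI) (auto simp: ring_mat_simps Phi_mult Phi_add Phi_one)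
qed

lemma mem_kernel_Phi:
  "x \<in> a_kernel (free_algebra (p + q)) (ring_mat TYPE(complex) d ()) Phi \<longleftrightarrow>
    x \<in> carrier (free_algebra (p + q)) \<and> Phi x = 0\<^sub>m d d"
  unfolding a_kernel_def' ring_mat_simps by (rule mem_Collect_eq)

text \<open>The kernel is an ideal containing the defining relations, hence it contains the ideal
  they generate.\<close>

lemma Phi_clifford_ideal:
  assumes "x \<in> clifford_ideal p q"
  shows "x \<in> carrier (free_algebra (p + q))" "Phi x = 0\<^sub>m d d"
proof -
  interpret ring_hom_ring "free_algebra (p + q)" "ring_mat TYPE(complex) d ()" Phi
    by (rule Phi_ring_hom)
  have "clifford_relations p q \<subseteq> a_kernel (free_algebra (p + q)) (ring_mat TYPE(complex) d ()) Phi"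
  proof
    fix x assume x: "x \<in> clifford_relations p q"
    then consider i where "i < p + q"
        "x = free_gen i * free_gen i - free_scalar (clifford_sign p i)"
      | i j where "i < p + q" "j < p + q" "i \<noteq> j"
        "x = free_gen i * free_gen j + free_gen j * free_gen i"
      by (auto simp: clifford_relations_def)
    then have "Phi x = 0\<^sub>m d d"
    proof cases
      case 1
      then show ?thesis by (simp add: Phi_diff Phi_mult Phi_gen Phi_scalar vs_square)
    next
      case 2
      then show ?thesis
        using vs_carrier[of i] vs_carrier[of j] uminus_l_inv_mat[of "vs ! j * vs ! i" d d]
        by (simp add: Phi_add Phi_mult Phi_gen vs_anticommute[of i j])
    qed
    moreover have "x \<in> carrier (free_algebra (p + q))"
      using x clifford_relations_subset by (rule rev_subsetD)
    ultimately show "x \<in> a_kernel (free_algebra (p + q)) (ring_mat TYPE(complex) d ()) Phi"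
      unfolding mem_kernel_Phi by (rule conjI[rotated])
  qed
  then have "clifford_ideal p q \<subseteq> a_kernel (free_algebra (p + q)) (ring_mat TYPE(complex) d ()) Phi"
    unfolding clifford_ideal_def by (rule R.genideal_minimal[OF kernel_is_ideal])
  from subsetD[OF this assms] show "x \<in> carrier (free_algebra (p + q))" "Phi x = 0\<^sub>m d d"
    unfolding mem_kernel_Phi by simp_all
qed

end

section \<open>Surjectivity and kernel of \<open>Phi\<close>\<close>

context clifford_basis
begin

lemma Phi_set_mon_sum:
  assumes "finite I" "I \<subseteq> Pow {..<p + q}" "i < d" "j < d"
  shows "Phi (\<Sum>S\<in>I. set_mon S (c S)) $$ (i, j) =
    (\<Sum>S\<in>I. complex_of_real (c S) * mword (set_word S) $$ (i, j))"
  using assms(1,2)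
proof (induction I rule: finite_induct)
  case (insert S I)
  then have S: "set (set_word S) \<subseteq> {..<p + q}" using set_word_subset[of S] by simp
  show ?case
    using insert assms(3,4) S mword_carrier[OF S] by (simp add: Phi_add set_mon_def Phi_word_mon)
qed (use assms in \<open>simp add: Phi_zero\<close>)

lemma set_mon_sum_closed:
  assumes "finite I" "I \<subseteq> Pow {..<p + q}"
  shows "(\<Sum>S\<in>I. set_mon S (c S)) \<in> carrier (free_algebra (p + q))"
  using assms
proof (induction I rule: finite_induct)
  case (insert S I)
  then have "set (set_word S) \<subseteq> {..<p + q}" using set_word_subset[of S] by simp
  with insert show ?case by (simp add: set_mon_def word_mon_closed)
qed simp

lemma Phi_surj: "Phi ` carrier (free_algebra (p + q)) = carrier_mat d d"
proof (intro equalityI subsetI)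
  fix X :: "complex mat" assume X: "X \<in> carrier_mat d d"
  obtain c where c: "\<forall>i<d. \<forall>j<d. X $$ (i, j) =
      (\<Sum>S\<in>Pow {..<p + q}. complex_of_real (c S) * mword (set_word S) $$ (i, j))"
    using spanning by blast
  have "X = Phi (\<Sum>S\<in>Pow {..<p + q}. set_mon S (c S))"
    using X c by (intro eq_matI) (auto simp: Phi_set_mon_sum)
  then show "X \<in> Phi ` carrier (free_algebra (p + q))"
    using set_mon_sum_closed by blast
qed auto

text \<open>An element of the kernel is congruent to a normal form that \<open>Phi\<close> also
  annihilates. Independence of the increasing words makes all its coefficients 0, so the element
  lies in the ideal.\<close>

lemma Phi_kernel:
  "a_kernel (free_algebra (p + q)) (ring_mat TYPE(complex) d ()) Phi = clifford_ideal p q"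
proof (intro equalityI subsetI)
  fix x assume "x \<in> a_kernel (free_algebra (p + q)) (ring_mat TYPE(complex) d ()) Phi"
  then have x: "x \<in> carrier (free_algebra (p + q))" "Phi x = 0\<^sub>m d d"
    unfolding mem_kernel_Phi by simp_all
  then obtain c where c: "cl_cong p q x (\<Sum>S \<in> Pow {..<p + q}. set_mon S (c S))"
    using cl_cong_normal_form by blast
  let ?n = "\<Sum>S \<in> Pow {..<p + q}. set_mon S (c S)"
  have "Phi (x - ?n) = 0\<^sub>m d d"
    using c Phi_clifford_ideal(2) by (simp add: cl_cong_def)
  then have "Phi ?n = 0\<^sub>m d d"
    using Phi_add[of "x - ?n" ?n] x(2) Phi_carrier[of ?n] by simp
  then have "(\<Sum>S\<in>Pow {..<p + q}. complex_of_real (c S) * mword (set_word S) $$ (i, j)) = 0"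
    if "i < d" "j < d" for i j
    using that by (simp flip: Phi_set_mon_sum)
  then have "c S = 0" if "S \<in> Pow {..<p + q}" for S
    using independent that by blast
  then have "?n = 0" by (simp add: set_mon_def word_mon_def)
  with c show "x \<in> clifford_ideal p q" by (simp add: cl_cong_def)
next
  fix x assume "x \<in> clifford_ideal p q"
  then show "x \<in> a_kernel (free_algebra (p + q)) (ring_mat TYPE(complex) d ()) Phi"
    unfolding mem_kernel_Phi using Phi_clifford_ideal by blast
qed

theorem one_vector_basis:
  assumes "length vs = p + q"
  shows "one_vector_basis p q d vs"
proof -
  interpret ring_hom_ring "free_algebra (p + q)" "ring_mat TYPE(complex) d ()" Phi
    by (rule Phi_ring_hom)
  \<comment> \<open>The map of the first isomorphism theorem: \<open>Phi\<close> is constant on a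
    coset of its kernel, and \<open>the_elem\<close> extracts that value.\<close>
  let ?\<phi> = "\<lambda>X. the_elem (Phi ` X)"
  have iso: "?\<phi> \<in> ring_iso (Cl p q) (ring_mat TYPE(complex) d ())"
    using FactRing_iso_set_aux
    unfolding Phi_surj Phi_kernel Cl_def by (simp add: ring_mat_def)
  have "?\<phi> (Cl_class p q x) = Phi x" if "x \<in> carrier (free_algebra (p + q))" for x
    using the_elem_simp[OF that] by (simp add: Phi_kernel Cl_class_def)
  then have \<phi>: "\<forall>r. ?\<phi> (Cl_class p q (free_scalar r)) = complex_of_real r \<cdot>\<^sub>m 1\<^sub>m d"
    "\<forall>i<p + q. ?\<phi> (Cl_class p q (free_gen i)) = vs ! i"
    by (simp_all add: Phi_scalar Phi_gen)
  show ?thesis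
    unfolding one_vector_basis_def
  proof (intro conjI)
    show "set vs \<subseteq> carrier_mat d d"
      using vs_carrier assms by (auto simp: in_set_conv_nth)
    show "\<forall>i<p + q. vs ! i * vs ! i = complex_of_real (clifford_sign p i) \<cdot>\<^sub>m 1\<^sub>m d"
      by (intro allI impI vs_square)
    show "\<forall>i<p + q. \<forall>j<p + q. i \<noteq> j \<longrightarrow> vs ! i * vs ! j = - (vs ! j * vs ! i)"
      by (intro allI impI vs_anticommute)
    show "\<exists>\<phi>\<in>ring_iso (Cl p q) (ring_mat TYPE(complex) d ()).
        (\<forall>r. \<phi> (Cl_class p q (free_scalar r)) = complex_of_real r \<cdot>\<^sub>m 1\<^sub>m d) \<and>
        (\<forall>i<p + q. \<phi> (Cl_class p q (free_gen i)) = vs ! i)"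
      by (intro bexI[OF _ iso] conjI \<phi>)
  qed (fact assms)
qed

end

section \<open>Anti-automorphisms\<close>

lemma mat_adjoint_simps [simp]:
  "dim_row (mat_adjoint A) = dim_col A" "dim_col (mat_adjoint A) = dim_row A"
  by (simp_all add: mat_adjoint_def)

lemma mat_adjoint_index [simp]:
  "i < dim_col A \<Longrightarrow> j < dim_row A \<Longrightarrow> mat_adjoint A $$ (i, j) = conjugate (A $$ (j, i))"
  by (simp add: mat_adjoint_def mat_of_rows_index)

lemma mat_adjoint_mult:
  fixes A B :: "complex mat"
  assumes "A \<in> carrier_mat n m" "B \<in> carrier_mat m k"
  shows "mat_adjoint (A * B) = mat_adjoint B * mat_adjoint A"
  using assms
  by (intro eq_matI) (auto simp: scalar_prod_def mult.commute)

lemma real_anti_automorphism_transpose: "real_anti_automorphism d transpose_mat"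
  unfolding real_anti_automorphism_def
proof (intro conjI ballI allI)
  show "bij_betw transpose_mat (carrier_mat d d) (carrier_mat d d)"
    by (rule bij_betw_byWitness[where f' = transpose_mat]) auto
qed (auto simp: transpose_add transpose_mult transpose_one intro!: eq_matI)

text \<open>The adjoint is conjugate-linear, but conjugation fixes the real scalars, the only ones
  the definition speaks of.\<close>

lemma real_anti_automorphism_adjoint: "real_anti_automorphism d mat_adjoint"
  unfolding real_anti_automorphism_def
proof (intro conjI ballI allI)
  show "bij_betw mat_adjoint (carrier_mat d d) (carrier_mat d d)"
    by (rule bij_betw_byWitness[where f' = mat_adjoint]) (auto intro!: eq_matI)
qed (auto simp: mat_adjoint_mult intro!: eq_matI)

lemma real_anti_automorphismD:
  assumes "real_anti_automorphism d f"
  shows "bij_betw f (carrier_mat d d) (carrier_mat d d)"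
    and "X \<in> carrier_mat d d \<Longrightarrow> f X \<in> carrier_mat d d"
    and "X \<in> carrier_mat d d \<Longrightarrow> Y \<in> carrier_mat d d \<Longrightarrow> f (X + Y) = f X + f Y"
    and "X \<in> carrier_mat d d \<Longrightarrow> f (complex_of_real r \<cdot>\<^sub>m X) = complex_of_real r \<cdot>\<^sub>m f X"
    and "X \<in> carrier_mat d d \<Longrightarrow> Y \<in> carrier_mat d d \<Longrightarrow> f (X * Y) = f Y * f X"
    and "f (1\<^sub>m d) = 1\<^sub>m d"
  using assms by (auto simp: real_anti_automorphism_def dest: bij_betwE)

text \<open>An anti-automorphism followed by an inner automorphism is again an
  anti-automorphism.\<close>

lemma real_anti_automorphism_conjugate:
  assumes f: "real_anti_automorphism d f"
    and P: "P \<in> carrier_mat d d" and Q: "Q \<in> carrier_mat d d"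
    and inverse: "Q * P = 1\<^sub>m d" "P * Q = 1\<^sub>m d"
  shows "real_anti_automorphism d (\<lambda>X. Q * f X * P)"
proof -
  note fD = real_anti_automorphismD[OF f]
  note assoc = assoc_mult_mat[where ?n\<^sub>1 = d and ?n\<^sub>2 = d and ?n\<^sub>3 = d and ?n\<^sub>4 = d]
  have cancel: "P * (Q * Z) = Z" "Q * (P * Z) = Z" if "Z \<in> carrier_mat d d" for Z
    using that P Q inverse by (simp_all flip: assoc)
  have "bij_betw (\<lambda>X. Q * X * P) (carrier_mat d d) (carrier_mat d d)"
    by (rule bij_betw_byWitness[where f' = "\<lambda>X. P * X * Q"])
       (use P Q inverse in \<open>auto simp: assoc cancel\<close>)
  from bij_betw_trans[OF fD(1) this]
  have "bij_betw (\<lambda>X. Q * f X * P) (carrier_mat d d) (carrier_mat d d)"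
    by (simp add: comp_def)
  moreover have "Q * f (X * Y) * P = Q * f Y * P * (Q * f X * P)"
    if "X \<in> carrier_mat d d" "Y \<in> carrier_mat d d" for X Y
    using that P Q
    by (simp add: fD assoc cancel mult_carrier_mat[where n = d])
  ultimately show ?thesis
    unfolding real_anti_automorphism_def
    using P Q inverse
    by (auto simp: fD(2-4,6) assoc cancel mult_add_distrib_mat[where n = d and nr = d and nc = d]
        add_mult_distrib_mat[where n = d and nr = d and nc = d]
        mult_smult_assoc_mat[where n = d and nr = d and nc = d]
        mult_smult_distrib[where n = d and nr = d and nc = d])
qed

text \<open>The definite descriptions range over extensional functions, so the candidate has to be
  restricted.\<close>

lemma real_anti_automorphism_restrict:
  assumes f: "real_anti_automorphism d f"
  shows "real_anti_automorphism d (restrict f (carrier_mat d d))"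
proof -
  have "bij_betw (restrict f (carrier_mat d d)) (carrier_mat d d) (carrier_mat d d)"
    using real_anti_automorphismD(1)[OF f] by (simp cong: bij_betw_cong)
  then show ?thesis
    using real_anti_automorphismD(2-)[OF f]
    by (simp add: real_anti_automorphism_def)
qed

text \<open>Real linearity carries the rule from the generators to their span. The scalar
  \<open>s\<close> serves reversion with 1 and Clifford conjugation with -1.\<close>

lemma real_anti_automorphism_one_vectors:
  assumes f: "real_anti_automorphism d f"
    and vs: "\<And>i. i < length vs \<Longrightarrow> vs ! i \<in> carrier_mat d d"
    and gen: "\<And>i. i < length vs \<Longrightarrow> f (vs ! i) = complex_of_real s \<cdot>\<^sub>m vs ! i"
    and v: "v \<in> one_vectors d vs"
  shows "f v = complex_of_real s \<cdot>\<^sub>m v"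
proof -
  interpret R: ring "ring_mat TYPE(complex) d ()" by (rule ring_mat)
  note fD = real_anti_automorphismD[OF f]
  obtain c where v: "v = finsum (ring_mat TYPE(complex) d ())
      (\<lambda>i. complex_of_real (c i) \<cdot>\<^sub>m vs ! i) {..<length vs}"
    using v unfolding one_vectors_def by blast
  let ?F = "\<lambda>k. finsum (ring_mat TYPE(complex) d ()) (\<lambda>i. complex_of_real (c i) \<cdot>\<^sub>m vs ! i) {..<k}"
  have "?F k \<in> carrier_mat d d \<and> f (?F k) = complex_of_real s \<cdot>\<^sub>m ?F k" if "k \<le> length vs" for k
    using that
  proof (induction k)
    case 0
    \<comment> \<open>That \<open>f\<close> sends zero to zero follows from real homogeneity with
      the scalar 0.\<close>
    have "f (0\<^sub>m d d) = f (complex_of_real 0 \<cdot>\<^sub>m 0\<^sub>m d d)" by simp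
    also have "\<dots> = complex_of_real 0 \<cdot>\<^sub>m f (0\<^sub>m d d)"
      by (rule fD(4)) simp
    also have "\<dots> = 0\<^sub>m d d"
      using fD(2)[of "0\<^sub>m d d"] by (intro eq_matI) auto
    finally show ?case by (simp add: ring_mat_simps)
  next
    case (Suc k)
    have "vs ! k \<in> carrier_mat d d" using vs Suc.prems by simp
    moreover have "?F (Suc k) = complex_of_real (c k) \<cdot>\<^sub>m vs ! k + ?F k"
      using Suc.prems vs
      by (simp add: lessThan_Suc R.finsum_insert ring_mat_simps Pi_def)
    ultimately show ?case
      using Suc by (simp add: fD gen add_smult_distrib_left_mat[where nr = d and nc = d]
          smult_smult_mat mult.commute)
  qed
  then show ?thesis unfolding v by blast
qed

lemma nth_in_one_vectors:
  assumes vs: "\<And>i. i < length vs \<Longrightarrow> vs ! i \<in> carrier_mat d d" and i: "i < length vs"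
  shows "vs ! i \<in> one_vectors d vs"
proof -
  interpret R: ring "ring_mat TYPE(complex) d ()" by (rule ring_mat)
  let ?c = "\<lambda>j. if i = j then 1 else 0 :: real"
  have zero: "0 \<cdot>\<^sub>m A = 0\<^sub>m d d" if "A \<in> carrier_mat d d" for A :: "complex mat"
    using that by (intro eq_matI) auto
  have "finsum (ring_mat TYPE(complex) d ()) (\<lambda>j. complex_of_real (?c j) \<cdot>\<^sub>m vs ! j) {..<length vs} =
    finsum (ring_mat TYPE(complex) d ())
      (\<lambda>j. if i = j then vs ! j else \<zero>\<^bsub>ring_mat TYPE(complex) d ()\<^esub>) {..<length vs}"
    using vs by (intro R.finsum_cong') (auto simp: ring_mat_simps zero)
  also have "\<dots> = vs ! i"
    using vs i by (intro R.finsum_singleton) (auto simp: ring_mat_simps)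
  finally show ?thesis
    unfolding one_vectors_def by (intro CollectI exI[of _ ?c]) simp
qed

section \<open>Uniqueness, and evaluation of the definite descriptions\<close>

context clifford_basis
begin

text \<open>Agreement passes from generators to words by reversing products, then to real
  combinations of words; since \<open>Phi\<close> is surjective, these are all matrices.\<close>

lemma real_anti_automorphism_unique:
  assumes f: "real_anti_automorphism d f" and g: "real_anti_automorphism d g"
    and gens: "\<And>i. i < p + q \<Longrightarrow> f (vs ! i) = g (vs ! i)"
    and X: "X \<in> carrier_mat d d"
  shows "f X = g X"
proof -
  note fD = real_anti_automorphismD[OF f] and gD = real_anti_automorphismD[OF g]
  have word: "f (mword w) = g (mword w)" if "set w \<subseteq> {..<p + q}" for w
    using that
  proof (induction w)
    case (Cons i w)
    then show ?case
      using vs_carrier[of i] mword_carrier[of w] by (simp add: fD gD gens)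
  qed (simp add: fD gD)
  obtain x where x: "x \<in> carrier (free_algebra (p + q))" "X = Phi x"
    using X Phi_surj by blast
  from x(1) have "f (Phi x) = g (Phi x)"
  proof (induction x rule: free_algebra_induct)
    case (single w r)
    then show ?case by (simp add: Phi_single fD gD mword_carrier word)
  next
    case (add x y)
    then show ?case by (simp add: Phi_add fD gD)
  qed
  then show ?thesis using x(2) by simp
qed

text \<open>Existence is given by \<open>f\<close>. For uniqueness, the generators are 1-vectors, so
  any competitor agrees with \<open>f\<close> on them.\<close>

lemma the_anti_automorphism:
  assumes len: "length vs = p + q" and f: "real_anti_automorphism d f"
    and gen: "\<And>i. i < p + q \<Longrightarrow> f (vs ! i) = complex_of_real s \<cdot>\<^sub>m vs ! i"
  shows "(THE g. g \<in> extensional (carrier_mat d d) \<and> real_anti_automorphism d g \<and>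
    (\<forall>v \<in> one_vectors d vs. g v = complex_of_real s \<cdot>\<^sub>m v)) = restrict f (carrier_mat d d)"
proof (rule the_equality, intro conjI ballI)
  have vs: "vs ! i \<in> carrier_mat d d" if "i < length vs" for i
    using vs_carrier that len by simp
  let ?f = "restrict f (carrier_mat d d)"
  show f': "real_anti_automorphism d ?f"
    by (rule real_anti_automorphism_restrict[OF f])
  show "?f v = complex_of_real s \<cdot>\<^sub>m v" if "v \<in> one_vectors d vs" for v
    using vs gen len by (intro real_anti_automorphism_one_vectors[OF f' _ _ that]) auto
  fix g assume g: "g \<in> extensional (carrier_mat d d) \<and> real_anti_automorphism d g \<and>
    (\<forall>v \<in> one_vectors d vs. g v = complex_of_real s \<cdot>\<^sub>m v)"
  show "g = ?f"
  proof (rule extensionalityI[of _ "carrier_mat d d :: complex mat set"])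
    fix X :: "complex mat" assume X: "X \<in> carrier_mat d d"
    have "g (vs ! i) = f (vs ! i)" if "i < p + q" for i
      using g gen[OF that] nth_in_one_vectors[OF vs, of i] that len by simp
    with g f X show "g X = ?f X"
      by (simp add: real_anti_automorphism_unique[of g f])
  qed (use g in auto)
qed simp

lemma reversion_eq:
  assumes "length vs = p + q" "real_anti_automorphism d f"
    and "\<And>i. i < p + q \<Longrightarrow> f (vs ! i) = vs ! i" "X \<in> carrier_mat d d"
  shows "reversion d vs X = f X"
  using the_anti_automorphism[OF assms(1,2), of 1] assms(3,4) by (simp add: reversion_def)

lemma clifford_conjugation_eq:
  assumes "length vs = p + q" "real_anti_automorphism d f"
    and "\<And>i. i < p + q \<Longrightarrow> f (vs ! i) = - (vs ! i)" "X \<in> carrier_mat d d"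
  shows "clifford_conjugation d vs X = f X"
proof -
  have neg: "complex_of_real (- 1) \<cdot>\<^sub>m A = - A" for A
    by (rule eq_matI) auto
  show ?thesis
    using the_anti_automorphism[OF assms(1,2), of "- 1"] assms(3,4)
    by (simp only: neg clifford_conjugation_def) simp
qed

end

section \<open>The matrices \<open>F\<^sub>i\<close>\<close>

text \<open>Unfolding gives a literal list of lists. Matrix operations return this form again, so
  iterated products are evaluated by rewriting.\<close>

definition tab4 :: "(nat \<Rightarrow> nat \<Rightarrow> 'a) \<Rightarrow> 'a list list" where
  "tab4 f = map (\<lambda>i. map (f i) [0, 1, 2, 3]) [0, 1, 2, 3]"

definition mat4 :: "'a list list \<Rightarrow> 'a mat" where
  "mat4 A = mat 4 4 (\<lambda>(i, j). A ! i ! j)"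

lemma mat4_carrier [simp]: "mat4 A \<in> carrier_mat 4 4"
  and mat4_dim [simp]: "dim_row (mat4 A) = 4" "dim_col (mat4 A) = 4"
  by (simp_all add: mat4_def)

lemma less_4_cases: "(i :: nat) < 4 \<longleftrightarrow> i = 0 \<or> i = 1 \<or> i = 2 \<or> i = 3"
  by auto

lemma tab4_index: "i < 4 \<Longrightarrow> j < 4 \<Longrightarrow> tab4 f ! i ! j = f i j"
  by (auto simp: tab4_def less_4_cases)

lemma mat4_tab4: "mat4 (tab4 f) = mat 4 4 (\<lambda>(i, j). f i j)"
  by (rule eq_matI) (simp_all add: mat4_def tab4_index)

lemma mat4_mult:
  "mat4 A * mat4 B = mat4 (tab4 (\<lambda>i j.
    A ! i ! 0 * B ! 0 ! j + A ! i ! 1 * B ! 1 ! j + A ! i ! 2 * B ! 2 ! j + A ! i ! 3 * B ! 3 ! j))"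
  unfolding mat4_tab4
  by (rule eq_matI) (simp_all add: mat4_def scalar_prod_def eval_nat_numeral add.assoc)

lemma mat4_uminus: "- mat4 A = mat4 (tab4 (\<lambda>i j. - A ! i ! j))"
  unfolding mat4_tab4 by (rule eq_matI) (simp_all add: mat4_def)

lemma mat4_transpose: "transpose_mat (mat4 A) = mat4 (tab4 (\<lambda>i j. A ! j ! i))"
  unfolding mat4_tab4 by (rule eq_matI) (simp_all add: mat4_def)

lemma mat4_adjoint: "mat_adjoint (mat4 A) = mat4 (tab4 (\<lambda>i j. conjugate (A ! j ! i)))"
  unfolding mat4_tab4 by (rule eq_matI) (simp_all add: mat4_def)

lemma mat4_one: "1\<^sub>m 4 = mat4 (tab4 (\<lambda>i j. if i = j then 1 else 0))"
  unfolding mat4_tab4 one_mat_def by simp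

lemma mat4_smult: "c \<cdot>\<^sub>m mat4 A = mat4 (tab4 (\<lambda>i j. c * A ! i ! j))"
  unfolding mat4_tab4 by (rule eq_matI) (simp_all add: mat4_def)

lemmas mat4_simps = mat4_mult mat4_uminus mat4_transpose mat4_adjoint mat4_one mat4_smult

section \<open>The matrices \<open>F_list\<close> and \<open>J4_hat\<close> as explicit
  tables\<close>

lemma pauli_simps:
  "dim_row pauli_x = 2" "dim_col pauli_x = 2" "pauli_x $$ (0, 0) = 0" "pauli_x $$ (0, Suc 0) = 1"
  "pauli_x $$ (Suc 0, 0) = 1" "pauli_x $$ (Suc 0, Suc 0) = 0"
  "dim_row pauli_y = 2" "dim_col pauli_y = 2" "pauli_y $$ (0, 0) = 0" "pauli_y $$ (0, Suc 0) = - \<i>"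
  "pauli_y $$ (Suc 0, 0) = \<i>" "pauli_y $$ (Suc 0, Suc 0) = 0"
  "dim_row pauli_z = 2" "dim_col pauli_z = 2" "pauli_z $$ (0, 0) = 1" "pauli_z $$ (0, Suc 0) = 0"
  "pauli_z $$ (Suc 0, 0) = 0" "pauli_z $$ (Suc 0, Suc 0) = - 1"
  by (simp_all add: pauli_x_def pauli_y_def pauli_z_def mat_of_rows_list_def)

lemma F_list_mat4: "F_list = map mat4
   [[[0, 0, 0, - \<i>], [0, 0, - \<i>, 0], [0, - \<i>, 0, 0], [- \<i>, 0, 0, 0]],
    [[0, 0, 0, - 1], [0, 0, 1, 0], [0, - 1, 0, 0], [1, 0, 0, 0]],
    [[0, 0, - \<i>, 0], [0, 0, 0, \<i>], [- \<i>, 0, 0, 0], [0, \<i>, 0, 0]],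
    [[\<i>, 0, 0, 0], [0, \<i>, 0, 0], [0, 0, - \<i>, 0], [0, 0, 0, - \<i>]],
    [[0, 0, 1, 0], [0, 0, 0, 1], [- 1, 0, 0, 0], [0, - 1, 0, 0]]]"
  unfolding F_list_def list.map list.inject
  by (intro conjI refl eq_matI)
     (auto simp: kronecker_def pauli_simps J_mat_def mat4_def less_4_cases)

lemma J4_hat_mat4: "J4_hat = mat4
   [[0, 1, 0, 0], [- 1, 0, 0, 0], [0, 0, 0, - 1], [0, 0, 1, 0]]"
  by (rule eq_matI)
     (auto simp: J4_hat_def J_mat_def mat4_def less_4_cases)

lemma less_5_cases: "(k :: nat) < 5 \<longleftrightarrow> k = 0 \<or> k = 1 \<or> k = 2 \<or> k = 3 \<or> k = 4"
  by auto

lemma F_carrier: "k < 5 \<Longrightarrow> F_list ! k \<in> carrier_mat 4 4"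
  unfolding less_5_cases by (auto simp: F_list_mat4)

lemma J4_hat_carrier: "J4_hat \<in> carrier_mat 4 4"
  by (simp add: J4_hat_mat4)

lemma J4_hat_square: "J4_hat * J4_hat = - 1\<^sub>m 4"
  unfolding J4_hat_mat4 by (simp add: mat4_simps tab4_def)

lemma F_square: "k < 5 \<Longrightarrow> F_list ! k * F_list ! k = - 1\<^sub>m 4"
  unfolding less_5_cases F_list_mat4
  by (elim disjE) (simp_all add: mat4_simps tab4_def)

lemma F_anticommute:
  "j < 5 \<Longrightarrow> k < 5 \<Longrightarrow> j \<noteq> k \<Longrightarrow> F_list ! j * F_list ! k = - (F_list ! k * F_list ! j)"
  unfolding less_5_cases F_list_mat4
  by (elim disjE) (simp_all add: mat4_simps tab4_def)

text \<open>On the five matrices the adjoint acts as Clifford conjugation; the sign is repaired in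
  size 8 when \<open>K_mat 4\<close> exchanges the blocks \<open>F\<close> and
  \<open>- F\<close>.\<close>

lemma F_adjoint: "k < 5 \<Longrightarrow> mat_adjoint (F_list ! k) = - (F_list ! k)"
  unfolding less_5_cases F_list_mat4
  by (elim disjE) (simp_all add: mat4_simps tab4_def)

text \<open>As \<open>J4_hat\<close> has inverse \<open>- J4_hat\<close>, conjugating the transpose
  by \<open>J4_hat\<close> fixes each of the five matrices.\<close>

lemma F_transpose: "k < 5 \<Longrightarrow> J4_hat * transpose_mat (F_list ! k) * J4_hat = - (F_list ! k)"
  unfolding less_5_cases F_list_mat4 J4_hat_mat4
  by (elim disjE) (simp_all add: mat4_simps tab4_def)

text \<open>The point is that this scalar is purely imaginary, which yields the trace condition
  \<open>odd_trace\<close> in size 8.\<close>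

lemma F_prod:
  "F_list ! 0 * (F_list ! 1 * (F_list ! 2 * (F_list ! 3 * F_list ! 4))) = - \<i> \<cdot>\<^sub>m 1\<^sub>m 4"
  unfolding F_list_mat4 by (simp add: mat4_simps tab4_def)

section \<open>The basis of \<open>Cl(1,6)\<close>\<close>

abbreviation signed_diag :: "complex mat \<Rightarrow> complex mat" where
  "signed_diag F \<equiv> four_block_mat F (0\<^sub>m 4 4) (0\<^sub>m 4 4) (- F)"

lemma uminus_four_block_mat:
  assumes "A \<in> carrier_mat nr1 nc1" "B \<in> carrier_mat nr1 nc2"
    "C \<in> carrier_mat nr2 nc1" "D \<in> carrier_mat nr2 nc2"
  shows "- four_block_mat A B C D = four_block_mat (- A) (- B) (- C) (- D)"
  by (rule eq_matI) (use assms in auto)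

lemma adjoint_four_block_mat:
  assumes "A \<in> carrier_mat nr1 nc1" "B \<in> carrier_mat nr1 nc2"
    "C \<in> carrier_mat nr2 nc1" "D \<in> carrier_mat nr2 nc2"
  shows "mat_adjoint (four_block_mat A B C D) =
    four_block_mat (mat_adjoint A) (mat_adjoint C) (mat_adjoint B) (mat_adjoint D)"
  by (rule eq_matI) (use assms in auto)

lemma uminus_zero_mat [simp]: "- 0\<^sub>m n m = (0\<^sub>m n m :: 'a :: group_add mat)"
  by (rule eq_matI) auto

lemma mat_adjoint_zero [simp]: "mat_adjoint (0\<^sub>m n m :: complex mat) = 0\<^sub>m m n"
  and mat_adjoint_one [simp]: "mat_adjoint (1\<^sub>m n :: complex mat) = 1\<^sub>m n"
  and mat_adjoint_uminus: "mat_adjoint (- A) = - mat_adjoint (A :: complex mat)"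
  by (auto intro!: eq_matI)

text \<open>The sizes are fixed in advance because they occur in the carrier premises of the rules,
  which the simplifier has to discharge.\<close>

lemmas block4_simps =
  mult_four_block_mat[where ?nr1.0 = 4 and ?nr2.0 = 4 and ?n1.0 = 4 and ?n2.0 = 4 and ?nc1.0 = 4 and ?nc2.0 = 4]
  uminus_four_block_mat[where ?nr1.0 = 4 and ?nr2.0 = 4 and ?nc1.0 = 4 and ?nc2.0 = 4]
  transpose_four_block_mat[where ?nr1.0 = 4 and ?nr2.0 = 4 and ?nc1.0 = 4 and ?nc2.0 = 4]
  adjoint_four_block_mat[where ?nr1.0 = 4 and ?nr2.0 = 4 and ?nc1.0 = 4 and ?nc2.0 = 4]
  smult_four_block_mat[where ?nr1.0 = 4 and ?nr2.0 = 4 and ?nc1.0 = 4 and ?nc2.0 = 4]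
  left_mult_zero_mat[where nr = 4 and n = 4 and nc = 4]
  right_mult_zero_mat[where nr = 4 and n = 4 and nc = 4]
  left_mult_one_mat[where nr = 4 and nc = 4] right_mult_one_mat[where nr = 4 and nc = 4]
  left_add_zero_mat[where nr = 4 and nc = 4] right_add_zero_mat[where nr = 4 and nc = 4]
  mult_carrier_mat[where nr = 4 and n = 4 and nc = 4]

text \<open>Splits the identity into blocks; \<open>four_block_one_mat\<close> rewrites in the
  opposite direction and is removed where this is used.\<close>

lemma one_mat_8: "1\<^sub>m 8 = four_block_mat (1\<^sub>m 4) (0\<^sub>m 4 4) (0\<^sub>m 4 4) (1\<^sub>m 4)"
  using four_block_one_mat[of 4 4] by simp

lemma length_basis_1_6: "length basis_1_6 = 7"
  by (simp add: basis_1_6_def F_list_mat4)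

text \<open>The leading \<open>K_mat 4\<close> shifts the indices by one: generator
  \<open>Suc k\<close> comes from \<open>F_list ! k\<close>.\<close>

lemma basis_1_6_cases:
  assumes "i < (7 :: nat)"
  obtains "basis_1_6 ! i = K_mat 4" "i = 0"
  | k where "basis_1_6 ! i = signed_diag (F_list ! k)" "i = Suc k" "k < 5"
  | "basis_1_6 ! i = J_mat 4" "i = 6"
proof -
  have len: "length F_list = 5" by (simp add: F_list_mat4)
  consider "i = 0" | k where "i = Suc k" "k < 5" | "i = 6"
    using assms by (cases i) (auto, linarith)
  then show ?thesis
    using that by cases (auto simp: basis_1_6_def nth_append len)
qed

lemma K_square: "K_mat 4 * K_mat 4 = 1\<^sub>m 8"
  by (simp add: K_mat_def block4_simps one_mat_8 del: four_block_one_mat)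

lemma J_square: "J_mat 4 * J_mat 4 = - 1\<^sub>m 8"
  by (simp add: J_mat_def block4_simps one_mat_8 del: four_block_one_mat)

lemma K_J_anticommute: "K_mat 4 * J_mat 4 = - (J_mat 4 * K_mat 4)"
  by (simp add: J_mat_def K_mat_def block4_simps)

lemma signed_diag_square:
  "F \<in> carrier_mat 4 4 \<Longrightarrow> F * F = - 1\<^sub>m 4 \<Longrightarrow> signed_diag F * signed_diag F = - 1\<^sub>m 8"
  by (simp add: block4_simps one_mat_8 del: four_block_one_mat)

lemma signed_diag_anticommute:
  "F \<in> carrier_mat 4 4 \<Longrightarrow> G \<in> carrier_mat 4 4 \<Longrightarrow> F * G = - (G * F) \<Longrightarrow>
    signed_diag F * signed_diag G = - (signed_diag G * signed_diag F)"
  by (simp add: block4_simps)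

lemma signed_diag_K:
  "F \<in> carrier_mat 4 4 \<Longrightarrow> signed_diag F * K_mat 4 = - (K_mat 4 * signed_diag F)"
  by (simp add: block4_simps K_mat_def)

lemma signed_diag_J:
  "F \<in> carrier_mat 4 4 \<Longrightarrow> signed_diag F * J_mat 4 = - (J_mat 4 * signed_diag F)"
  by (simp add: block4_simps J_mat_def)

lemma K_J_carrier: "K_mat 4 \<in> carrier_mat 8 8" "J_mat 4 \<in> carrier_mat 8 8"
  by (auto simp: K_mat_def J_mat_def intro!: carrier_matI)

lemma signed_diag_carrier: "F \<in> carrier_mat 4 4 \<Longrightarrow> signed_diag F \<in> carrier_mat 8 8"
  by (auto intro!: carrier_matI)

section \<open>Clifford relations and the product of the seven generators\<close>

interpretation basis_1_6: clifford_matrices 1 6 8 basis_1_6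
proof
  fix i j :: nat
  have eq: "(- 1 :: complex) \<cdot>\<^sub>m 1\<^sub>m 8 = - 1\<^sub>m 8" by (rule eq_matI) auto
  assume "i < 1 + 6"
  then have i: "i < 7" by simp
  show "basis_1_6 ! i \<in> carrier_mat 8 8"
    using i by (cases rule: basis_1_6_cases) (simp_all add: K_J_carrier signed_diag_carrier F_carrier)
  show "basis_1_6 ! i * basis_1_6 ! i = complex_of_real (clifford_sign 1 i) \<cdot>\<^sub>m 1\<^sub>m 8"
    using i by (cases rule: basis_1_6_cases)
      (simp_all only: K_square J_square signed_diag_square F_carrier F_square clifford_sign_def, simp_all add: eq)
  assume "j < 1 + 6" and ij: "i \<noteq> j"
  then have j: "j < 7" by simp
  show "basis_1_6 ! i * basis_1_6 ! j = - (basis_1_6 ! j * basis_1_6 ! i)"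
    using i
  proof (cases rule: basis_1_6_cases)
    case 1
    note i = this
    show ?thesis using j
      by (cases rule: basis_1_6_cases)
         (use i ij in \<open>simp_all add: K_J_anticommute signed_diag_K F_carrier\<close>)
  next
    case (2 k)
    note i = this
    show ?thesis using j
    proof (cases rule: basis_1_6_cases)
      case (2 l)
      with i ij have "F_list ! k * F_list ! l = - (F_list ! l * F_list ! k)"
        by (intro F_anticommute) auto
      then show ?thesis
        unfolding i(1) 2(1) using i(3) 2(3) by (intro signed_diag_anticommute F_carrier)
    qed (use i in \<open>simp_all add: signed_diag_J signed_diag_K F_carrier\<close>)
  next
    case 3
    note i = this
    show ?thesis using j
      by (cases rule: basis_1_6_cases)
         (use i ij in \<open>simp_all add: K_J_anticommute signed_diag_J F_carrier\<close>)
  qed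
qed

lemma mword_basis_1_6: "basis_1_6.mword [0..<1 + 6] = - \<i> \<cdot>\<^sub>m 1\<^sub>m 8"
proof -
  have F: "F_list ! 0 \<in> carrier_mat 4 4" "F_list ! Suc 0 \<in> carrier_mat 4 4"
    "F_list ! 2 \<in> carrier_mat 4 4" "F_list ! 3 \<in> carrier_mat 4 4" "F_list ! 4 \<in> carrier_mat 4 4"
    by (simp_all add: F_carrier)
  have basis: "basis_1_6 = [K_mat 4, signed_diag (F_list ! 0), signed_diag (F_list ! Suc 0),
      signed_diag (F_list ! 2), signed_diag (F_list ! 3), signed_diag (F_list ! 4), J_mat 4]"
    by (simp add: basis_1_6_def F_list_mat4)
  have nth: "basis_1_6 ! 0 = K_mat 4" "basis_1_6 ! Suc 0 = signed_diag (F_list ! 0)"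
    "basis_1_6 ! 2 = signed_diag (F_list ! Suc 0)" "basis_1_6 ! 3 = signed_diag (F_list ! 2)"
    "basis_1_6 ! 4 = signed_diag (F_list ! 3)" "basis_1_6 ! 5 = signed_diag (F_list ! 4)"
    "basis_1_6 ! 6 = J_mat 4"
    by (simp_all add: basis)
  have "[0..<1 + 6] = [0, 1, 2, 3, 4, 5, 6]" by (simp add: upt_rec)
  then have "basis_1_6.mword [0..<1 + 6] =
      K_mat 4 * (signed_diag (F_list ! 0) * (signed_diag (F_list ! Suc 0) *
      (signed_diag (F_list ! 2) * (signed_diag (F_list ! 3) *
      (signed_diag (F_list ! 4) * J_mat 4)))))"
    using right_mult_one_mat[OF K_J_carrier(2)] by (simp add: nth)
  \<comment> \<open>The five middle factors multiply to \<open>- \<i>\<close> in the upper block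
    and, five being odd, to \<open>\<i>\<close> in the lower one; the outer factors
    \<open>K_mat 4\<close> and \<open>J_mat 4\<close> make the two blocks equal.\<close>
  also have "\<dots> = - \<i> \<cdot>\<^sub>m 1\<^sub>m 8"
    using F F_prod
    by (simp add: K_mat_def J_mat_def block4_simps one_mat_8 del: four_block_one_mat)
  finally show ?thesis .
qed

text \<open>Here \<open>2 ^ 7 = 2 * 8 ^ 2\<close>, and \<open>- \<i>\<close> times the identity has
  purely imaginary trace.\<close>

interpretation basis_1_6: clifford_basis 1 6 8 basis_1_6
proof
  show "Re (mat_tr (basis_1_6.mword [0..<1 + 6])) = 0"
    unfolding mword_basis_1_6 by (simp add: mat_tr_smult[where n = 8] mat_tr_one)
qed simp

section \<open>Inverses, and the two involutions on the basis\<close>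

lemma mat_inverse_eqI:
  fixes A B :: "'a :: field mat"
  assumes A: "A \<in> carrier_mat n n" and B: "B \<in> carrier_mat n n"
    and AB: "A * B = 1\<^sub>m n" "B * A = 1\<^sub>m n"
  shows "mat_inverse A = Some B"
proof (cases "mat_inverse A")
  case None
  then have "A \<notin> Units (ring_mat TYPE('a) n ())"
    by (rule mat_inverse(1)[OF A])
  \<comment> \<open>The inverse \<open>B\<close> makes \<open>A\<close> a unit, which rules out
    \<open>None\<close>.\<close>
  with A B AB show ?thesis by (auto simp: Units_def ring_mat_simps)
next
  case (Some C)
  then have C: "C \<in> carrier_mat n n" "C * A = 1\<^sub>m n"
    using mat_inverse(2)[OF A] by auto
  have "C = C * (A * B)" using C AB by simp
  also have "\<dots> = B" using A B C by (simp flip: assoc_mult_mat)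
  finally show ?thesis using Some by simp
qed

lemma invertible_matI:
  "A \<in> carrier_mat n n \<Longrightarrow> B \<in> carrier_mat n n \<Longrightarrow> A * B = 1\<^sub>m n \<Longrightarrow> B * A = 1\<^sub>m n \<Longrightarrow> invertible_mat A"
  by (auto simp: invertible_mat_def inverts_mat_def)

definition P8 :: "complex mat" where
  "P8 = four_block_mat (0\<^sub>m 4 4) J4_hat (- J4_hat) (0\<^sub>m 4 4)"

lemma P8_carrier: "P8 \<in> carrier_mat 8 8"
  using J4_hat_carrier by (auto simp: P8_def intro!: carrier_matI)

text \<open>Both diagonal blocks of the square are \<open>- (J4_hat * J4_hat)\<close>, the identity.
  So \<open>P8\<close> is its own inverse.\<close>

lemma P8_square: "P8 * P8 = 1\<^sub>m 8"
  using J4_hat_carrier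
  by (simp add: P8_def block4_simps one_mat_8 J4_hat_square del: four_block_one_mat)

text \<open>On the middle generators the blocks reduce to \<open>F_transpose\<close>; on
  \<open>K_mat 4\<close> and \<open>J_mat 4\<close> only \<open>J4_hat_square\<close> is
  involved.\<close>

lemma P8_transpose:
  assumes "i < 7"
  shows "P8 * transpose_mat (basis_1_6 ! i) * P8 = - (basis_1_6 ! i)"
  using assms
proof (cases rule: basis_1_6_cases)
  case (2 k)
  have F: "F_list ! k \<in> carrier_mat 4 4" by (rule F_carrier[OF 2(3)])
  note [simp] = F J4_hat_carrier carrier_matD[OF F] carrier_matD[OF J4_hat_carrier]
  show ?thesis
    using F_transpose[OF 2(3)]
    by (simp add: 2(1) P8_def block4_simps transpose_uminus)
qed (use J4_hat_carrier in
    \<open>simp_all add: P8_def K_mat_def J_mat_def block4_simps J4_hat_square transpose_uminus transpose_one\<close>)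

text \<open>Conjugation by \<open>K_mat 4\<close> exchanges the diagonal blocks, which offsets
  \<open>F_adjoint\<close>. For \<open>J_mat 4\<close>, which is skew-adjoint, it offsets the sign
  because the two matrices anticommute.\<close>

lemma K_adjoint:
  assumes "i < 7"
  shows "K_mat 4 * mat_adjoint (basis_1_6 ! i) * K_mat 4 = basis_1_6 ! i"
  using assms
proof (cases rule: basis_1_6_cases)
  case (2 k)
  have [simp]: "F_list ! k \<in> carrier_mat 4 4" by (rule F_carrier[OF 2(3)])
  show ?thesis
    by (simp add: 2(1) K_mat_def block4_simps mat_adjoint_uminus F_adjoint[OF 2(3)])
qed (simp_all add: K_mat_def J_mat_def block4_simps mat_adjoint_uminus)

theorem corollary3p2:
  shows "one_vector_basis 1 6 8 basis_1_6 \<and>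
    (let P = four_block_mat (0\<^sub>m 4 4) J4_hat (- J4_hat) (0\<^sub>m 4 4) in
      invertible_mat P \<and>
      (\<forall>X \<in> carrier_mat 8 8.
        clifford_conjugation 8 basis_1_6 X = the (mat_inverse P) * transpose_mat X * P)) \<and>
    invertible_mat (K_mat 4) \<and>
    (\<forall>X \<in> carrier_mat 8 8.
      reversion 8 basis_1_6 X = the (mat_inverse (K_mat 4)) * mat_adjoint X * K_mat 4)"
proof -
  note K = K_J_carrier(1)
  have len: "length basis_1_6 = 1 + 6" by (simp add: length_basis_1_6)
  \<comment> \<open>Being its own inverse, \<open>P8\<close> is used on both sides; the same is done
    with \<open>K_mat 4\<close> below.\<close>
  have "clifford_conjugation 8 basis_1_6 X = P8 * transpose_mat X * P8" if "X \<in> carrier_mat 8 8" for X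
    by (rule basis_1_6.clifford_conjugation_eq[OF len
          real_anti_automorphism_conjugate[OF real_anti_automorphism_transpose
            P8_carrier P8_carrier P8_square P8_square] _ that])
       (simp add: P8_transpose)
  moreover have "reversion 8 basis_1_6 X = K_mat 4 * mat_adjoint X * K_mat 4"
    if "X \<in> carrier_mat 8 8" for X
    by (rule basis_1_6.reversion_eq[OF len
          real_anti_automorphism_conjugate[OF real_anti_automorphism_adjoint
            K K K_square K_square] _ that])
       (simp add: K_adjoint)
  moreover have "the (mat_inverse P8) = P8" "the (mat_inverse (K_mat 4)) = K_mat 4"
    by (simp_all add: mat_inverse_eqI[OF P8_carrier P8_carrier P8_square P8_square]
        mat_inverse_eqI[OF K K K_square K_square])
  moreover have "invertible_mat P8" "invertible_mat (K_mat 4)"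
    by (rule invertible_matI[OF P8_carrier P8_carrier P8_square P8_square]
        invertible_matI[OF K K K_square K_square])+
  ultimately show ?thesis
    unfolding Let_def P8_def[symmetric]
    using basis_1_6.one_vector_basis[OF len] by simp
qed

end
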